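(* Let $x:[0,1]^2\to\mathbb{R}^3$ be a (smooth, regular, generic) parametrized surface patch such that for all $u_0<u_1$ and $v_0<v_1$ in $[0,1]$ the four points $x(u_0,v_0),x(u_1,v_0),x(u_1,v_1),x(u_0,v_1)$ lie on a common circle. Then the parameter lines of $x$ are principal curvature lines, and the patch is the image under a Möbius transformation of (a piece of) a surface of revolution, a cone, or a cylinder. Furthermore, every two principal curvature lines of the same family ($u\mapsto x(u,v_0)$ and $u\mapsto x(u,v_1)$, resp. $v\mapsto x(u_0,v)$ and $v\mapsto x(u_1,v)$) are mapped onto each other by an inversion in a sphere.
   Context: Here cone and cylinder are meant in the generalized sense (a union of lines through a common point, resp. of parallel lines), as arising from the classification of multi-circular nets as Möbius images of nets generated by reflections in planes through an axis and spheres centered on it (revolution), in concentric spheres and planes through their center (cone), or in parallel planes and planes orthogonal to them (cylinder).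
   Formalization: "Inversion in a sphere" is read with planes counted as spheres, so reflections in planes are allowed; with ordinary spheres only, the claim fails for the parallel circles of a round cylinder. *)

theory Defs
  imports "HOL-Analysis.Analysis"
begin

type_synonym patch = "real \<Rightarrow> real \<Rightarrow> real^3"

definition sq :: "real set" where "sq = {0..1}"

definition pdu :: "patch \<Rightarrow> patch" where
  "pdu f = (\<lambda>u v. vector_derivative (\<lambda>t. f t v) (at u within sq))"

definition pdv :: "patch \<Rightarrow> patch" where
  "pdv f = (\<lambda>u v. vector_derivative (\<lambda>t. f u t) (at v within sq))"

fun pd :: "bool list \<Rightarrow> patch \<Rightarrow> patch" where
  "pd [] f = f"
| "pd (b # bs) f = (if b then pdu (pd bs f) else pdv (pd bs f))"

definition smooth_patch :: "patch \<Rightarrow> bool" where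
  "smooth_patch x \<longleftrightarrow>
     (\<forall>bs. continuous_on (sq \<times> sq) (\<lambda>(u, v). pd bs x u v) \<and>
       (\<forall>u\<in>sq. \<forall>v\<in>sq.
          (\<lambda>t. pd bs x t v) differentiable (at u within sq) \<and>
          (\<lambda>t. pd bs x u t) differentiable (at v within sq)))"

definition regular_patch :: "patch \<Rightarrow> bool" where
  "regular_patch x \<longleftrightarrow> (\<forall>u\<in>sq. \<forall>v\<in>sq. cross3 (pdu x u v) (pdv x u v) \<noteq> 0)"

definition unit_normal :: "patch \<Rightarrow> patch" where
  "unit_normal x = (\<lambda>u v. sgn (cross3 (pdu x u v) (pdv x u v)))"

text \<open>A tangent vector w is a principal direction at (u,v) iff it is an
  eigenvector of the shape operator, i.e. dN(w) is parallel to w.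
  For the coordinate directions dN(x_u) = N_u and dN(x_v) = N_v.\<close>
definition umbilic :: "patch \<Rightarrow> real \<Rightarrow> real \<Rightarrow> bool" where
  "umbilic x u v \<longleftrightarrow> (\<exists>k. pdu (unit_normal x) u v = k *\<^sub>R pdu x u v \<and>
                            pdv (unit_normal x) u v = k *\<^sub>R pdv x u v)"

definition generic_patch :: "patch \<Rightarrow> bool" where
  "generic_patch x \<longleftrightarrow> (\<forall>u\<in>sq. \<forall>v\<in>sq. \<not> umbilic x u v)"

definition parameter_lines_principal :: "patch \<Rightarrow> bool" where
  "parameter_lines_principal x \<longleftrightarrow>
     (\<forall>u\<in>sq. \<forall>v\<in>sq.
        (\<exists>k1. pdu (unit_normal x) u v = k1 *\<^sub>R pdu x u v) \<and>
        (\<exists>k2. pdv (unit_normal x) u v = k2 *\<^sub>R pdv x u v))"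

definition concyclic :: "(real^3) set \<Rightarrow> bool" where
  "concyclic P \<longleftrightarrow> (\<exists>c r n. r > 0 \<and> n \<noteq> 0 \<and>
                       (\<forall>p\<in>P. dist p c = r \<and> n \<bullet> (p - c) = 0))"

text \<open>Points of R^3 plus infinity: None is the point at infinity.\<close>
type_synonym ext3 = "(real^3) option"

definition sphere_inversion :: "real^3 \<Rightarrow> real \<Rightarrow> ext3 \<Rightarrow> ext3" where
  "sphere_inversion c r p = (case p of
      None \<Rightarrow> Some c
    | Some q \<Rightarrow> (if q = c then None
                 else Some (c + (r\<^sup>2 / (norm (q - c))\<^sup>2) *\<^sub>R (q - c))))"

definition plane_reflection :: "real^3 \<Rightarrow> real \<Rightarrow> ext3 \<Rightarrow> ext3" where
  "plane_reflection a b p = map_option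
      (\<lambda>q. q - (2 * (a \<bullet> q - b) / (norm a)\<^sup>2) *\<^sub>R a) p"

definition gen_inversion :: "(ext3 \<Rightarrow> ext3) \<Rightarrow> bool" where
  "gen_inversion f \<longleftrightarrow>
     (\<exists>c r. r > 0 \<and> f = sphere_inversion c r) \<or>
     (\<exists>a b. a \<noteq> 0 \<and> f = plane_reflection a b)"

inductive mobius :: "(ext3 \<Rightarrow> ext3) \<Rightarrow> bool" where
  mobius_id: "mobius id"
| mobius_comp: "gen_inversion g \<Longrightarrow> mobius f \<Longrightarrow> mobius (g \<circ> f)"

text \<open>Surface of revolution generated by rotating a C1 curve g about the axis
  through a with direction e: the union of the circles about the axis through
  the points of g.\<close>
definition surface_of_revolution :: "(real^3) set \<Rightarrow> bool" where
  "surface_of_revolution S \<longleftrightarrow> (\<exists>a e g. e \<noteq> 0 \<and> g C1_differentiable_on UNIV \<and>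
     S = {p. \<exists>t. (p - a) \<bullet> e = (g t - a) \<bullet> e \<and>
                 norm ((p - a) - (((p - a) \<bullet> e) / (e \<bullet> e)) *\<^sub>R e) =
                 norm ((g t - a) - (((g t - a) \<bullet> e) / (e \<bullet> e)) *\<^sub>R e)})"

definition gen_cone :: "(real^3) set \<Rightarrow> bool" where
  "gen_cone S \<longleftrightarrow> (\<exists>c g. g C1_differentiable_on UNIV \<and>
     S = {c + s *\<^sub>R (g t - c) | s t. True})"

definition gen_cylinder :: "(real^3) set \<Rightarrow> bool" where
  "gen_cylinder S \<longleftrightarrow> (\<exists>d g. d \<noteq> 0 \<and> g C1_differentiable_on UNIV \<and>
     S = {g t + s *\<^sub>R d | s t. True})"

end

theory Submission
  imports Defs
begin

text \<open>
  Lift \<open>y\<close> to the null vector \<open>(1, y, |y|\<^sup>2)\<close> of the Lorentz space \<open>\<real> \<times> \<real>\<^sup>3 \<times> \<real>\<close>.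
  Letting the two \<open>v\<close>-values of a parameter rectangle coincide, the circle condition (in the form
  of Ptolemy's identity) says that for all \<open>u, u'\<close> the vectors \<open>x\<^sub>v(u,v)\<close> and \<open>x\<^sub>v(u',v)\<close> are tangent to a
  common circle. Hence \<open>x\<^sub>u \<bullet> x\<^sub>v = 0\<close>, and comparing three points of a \<open>u\<close>-line shows that the unit
  vector \<open>t = x\<^sub>v/|x\<^sub>v|\<close> satisfies \<open>t\<^sub>u = k(v) x\<^sub>u\<close>: the \<open>u\<close>-line lies on a sphere orthogonal to the
  \<open>v\<close>-lines. Together with the symmetric statement, this shows that the parameter lines are
  principal and yields a positive factor \<open>w\<close> such that the rescaled lift is a sum
  \<open>w (1, x, |x|\<^sup>2) = A(u) + B(v)\<close>.

  The rest is linear algebra. Since \<open>B(v\<^sub>1) - B(v\<^sub>0)\<close> does not depend on \<open>u\<close>, the Lorentz reflection in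
  it is an inversion mapping one \<open>u\<close>-line to the other. Differences of \<open>A\<close> are Lorentz orthogonal to
  differences of \<open>B\<close>, so one family of differences spans only a plane. If this plane contains a
  null vector, moving that point to infinity gives a cone or a cylinder; otherwise the plane
  is positive definite, and moving a null vector of its complement (a point of the axis)
  to infinity gives a surface of revolution.
\<close>

section \<open>Lorentz space\<close>

type_synonym lvec = "real \<times> (real^3) \<times> real"

text \<open>A form of signature (4,1): the vector \<open>(p, a, h)\<close> has norm
  \<open>a \<bullet> a - p * h\<close>. A vector \<open>D\<close> of positive norm stands for the
  sphere or plane of all \<open>y\<close> with \<open>lor D (lift y) = 0\<close>.\<close>

definition lor :: "lvec \<Rightarrow> lvec \<Rightarrow> real" where
  "lor a b = fst (snd a) \<bullet> fst (snd b) - (fst a * snd (snd b) + snd (snd a) * fst b) / 2"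

text \<open>Null vectors with first coordinate 0 represent the point at infinity.\<close>

definition lift :: "real^3 \<Rightarrow> lvec" where
  "lift y = (1, y, y \<bullet> y)"

lemma lor_commute: "lor a b = lor b a"
  by (simp add: lor_def inner_commute)

lemma lor_add_left: "lor (a + b) c = lor a c + lor b c"
  and lor_diff_left: "lor (a - b) c = lor a c - lor b c"
  and lor_scaleR_left: "lor (r *\<^sub>R a) c = r * lor a c"
  by (simp_all add: lor_def algebra_simps add_divide_distrib diff_divide_distrib)

lemma lor_add_right: "lor c (a + b) = lor c a + lor c b"
  and lor_diff_right: "lor c (a - b) = lor c a - lor c b"
  and lor_scaleR_right: "lor c (r *\<^sub>R a) = r * lor c a"
  by (simp_all add: lor_commute[of c] lor_add_left lor_diff_left lor_scaleR_left)

lemmas lor_simps = lor_add_left lor_diff_left lor_scaleR_left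
  lor_add_right lor_diff_right lor_scaleR_right

lemma lor_zero [simp]: "lor 0 a = 0" "lor a 0 = 0"
  by (simp_all add: lor_def)

lemma lor_lift: "lor (lift y) (lift z) = - (norm (y - z))\<^sup>2 / 2"
  unfolding lor_def lift_def power2_norm_eq_inner
  by (simp add: inner_diff_left inner_diff_right inner_commute field_simps)

lemma lor_lift_self [simp]: "lor (lift y) (lift y) = 0"
  by (simp add: lor_lift)

text \<open>The equation \<open>a \<bullet> a = p * h\<close> leaves two cases: \<open>p = 0\<close>
  forces \<open>a = 0\<close>, and otherwise division by \<open>p\<close> exhibits a lifted
  point.\<close>

lemma lor_null_cases:
  assumes "lor N N = 0" "N \<noteq> 0"
  obtains h where "h \<noteq> 0" "N = (0, 0, h)"
  | r c where "r \<noteq> 0" "N = r *\<^sub>R lift c"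
proof (cases "fst N = 0")
  case True
  obtain p a h where N: "N = (p, a, h)" by (cases N) auto
  have "a = 0" using assms(1) True by (simp add: lor_def N)
  then show thesis using that(1)[of h] assms(2) True N by (auto simp: zero_prod_def)
next
  case False
  obtain p a h where N: "N = (p, a, h)" by (cases N) auto
  have p: "p \<noteq> 0" using False N by simp
  have "a \<bullet> a = p * h" using assms(1) by (simp add: lor_def N)
  then have "N = p *\<^sub>R lift (a /\<^sub>R p)"
    using p by (simp add: N lift_def field_simps)
  then show thesis using that(2) p by blast
qed

text \<open>This is nondegeneracy: \<open>J\<close> is the Gram matrix of \<open>lor\<close>, hence
  injective, and it carries \<open>V\<close> into the Euclidean complement of \<open>span U\<close>
  in a space of dimension 5.\<close>

lemma dim_lor_orthogonal:
  fixes U V :: "lvec set"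
  assumes "\<And>a b. a \<in> U \<Longrightarrow> b \<in> V \<Longrightarrow> lor a b = 0"
  shows "dim U + dim V \<le> 5"
proof -
  define J :: "lvec \<Rightarrow> lvec" where "J a = (- snd (snd a) / 2, fst (snd a), - fst a / 2)" for a
  have lin: "linear J"
    by (rule linearI) (auto simp: J_def field_simps)
  have inj: "inj J"
    by (rule injI) (auto simp: J_def prod_eq_iff)
  have lorJ: "lor a b = a \<bullet> J b" for a b
    by (simp add: lor_def J_def inner_prod_def field_simps)
  let ?P = "{y \<in> UNIV. \<forall>x \<in> span U. orthogonal x y}"
  have "orthogonal x (J b)" if "b \<in> V" "x \<in> span U" for x b
  proof -
    have "x \<in> {x. orthogonal (J b) x}"
      using that(2)
      by (rule span_induct) (use assms that(1) in
          \<open>auto simp: orthogonal_def lorJ inner_commute subspace_def inner_add_right\<close>)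
    then show ?thesis by (simp add: orthogonal_commute)
  qed
  then have "J ` V \<subseteq> ?P" by auto
  then have "dim (J ` V) \<le> dim ?P" by (rule dim_subset)
  moreover have "dim (J ` V) = dim V"
    using lin inj by (intro dim_image_eq) (auto simp: inj_on_def)
  moreover have "dim ?P + dim (span U) = dim (UNIV :: lvec set)"
    by (rule dim_subspace_orthogonal_to_vectors) auto
  ultimately show ?thesis by simp
qed

text \<open>Along the line the norm is a quadratic polynomial in \<open>r\<close>, positive at 0 and
  with negative leading coefficient, so it has a real zero. \<open>D\<close> is a quarter of its
  discriminant.\<close>

lemma lor_null_on_line:
  assumes "lor a a > 0" "lor b b < 0"
  obtains r where "lor (a + r *\<^sub>R b) (a + r *\<^sub>R b) = 0"
proof -
  define D where "D = (lor a b)\<^sup>2 - lor a a * lor b b"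
  have "lor a a * lor b b < 0" using assms by (rule mult_pos_neg)
  then have D: "D \<ge> 0" using zero_le_power2[of "lor a b"] unfolding D_def by linarith
  define r where "r = (- lor a b + sqrt D) / lor b b"
  have *: "lor b b * r + lor a b = sqrt D" using assms by (simp add: r_def)
  have "lor b b * lor (a + r *\<^sub>R b) (a + r *\<^sub>R b) = (lor b b * r + lor a b)\<^sup>2 - D"
    by (simp add: lor_simps D_def lor_commute[of b a] power2_eq_square algebra_simps)
  also have "\<dots> = 0" using D by (simp add: *)
  finally show thesis using that assms by auto
qed

section \<open>Separable lifts: orthogonal differences and inversions between lines\<close>

lemma lor_rectangle_orthogonal:
  assumes "lor a a = 0" "lor b b = 0" "lor c c = 0" "lor d d = 0" "a - b = c - d"
  shows "lor (a - b) (b - d) = 0"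
proof -
  \<comment> \<open>The fourth corner of the parallelogram; its norm reduces to a multiple of the
    claimed product because the other three corners are null.\<close>
  have c: "c = a - b + d" using assms(5) by (simp add: algebra_simps)
  show ?thesis
    using assms(1,2,3,4) unfolding c
    by (simp add: lor_simps lor_commute[of b a] lor_commute[of d a] lor_commute[of d b])
qed

text \<open>Says that \<open>w u v *\<^sub>R lift (x u v)\<close> is a sum
  \<open>A(u) + B(v)\<close>. The form as a vanishing mixed difference avoids a choice of the
  summands.\<close>

definition separable_lift :: "patch \<Rightarrow> (real \<Rightarrow> real \<Rightarrow> real) \<Rightarrow> bool" where
  "separable_lift x w \<longleftrightarrow> (\<forall>u\<in>sq. \<forall>v\<in>sq. w u v > 0) \<and>
     (\<forall>u\<in>sq. \<forall>u'\<in>sq. \<forall>v\<in>sq. \<forall>v'\<in>sq.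
        w u v *\<^sub>R lift (x u v) - w u' v *\<^sub>R lift (x u' v) =
        w u v' *\<^sub>R lift (x u v') - w u' v' *\<^sub>R lift (x u' v'))"

lemma separable_lift_pos:
  "separable_lift x w \<Longrightarrow> u \<in> sq \<Longrightarrow> v \<in> sq \<Longrightarrow> w u v > 0"
  unfolding separable_lift_def by blast

lemma separable_lift_diff:
  "separable_lift x w \<Longrightarrow> u \<in> sq \<Longrightarrow> u' \<in> sq \<Longrightarrow> v \<in> sq \<Longrightarrow> v' \<in> sq \<Longrightarrow>
    w u v *\<^sub>R lift (x u v) - w u' v *\<^sub>R lift (x u' v) =
    w u v' *\<^sub>R lift (x u v') - w u' v' *\<^sub>R lift (x u' v')"
  unfolding separable_lift_def by blast

lemma separable_lift_swap:
  assumes "separable_lift x w"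
  shows "separable_lift (\<lambda>u v. x v u) (\<lambda>u v. w v u)"
  unfolding separable_lift_def
proof (intro conjI ballI)
  have *: "a - b = c - d \<Longrightarrow> a - c = b - d" for a b c d :: lvec
    by (simp add: algebra_simps)
  fix u u' v v' assume "u \<in> sq" "u' \<in> sq" "v \<in> sq" "v' \<in> sq"
  then show "w v u *\<^sub>R lift (x v u) - w v u' *\<^sub>R lift (x v u') =
      w v' u *\<^sub>R lift (x v' u) - w v' u' *\<^sub>R lift (x v' u')"
    using *[OF separable_lift_diff[OF assms]] by blast
qed (use assms in \<open>unfold separable_lift_def, blast\<close>)

text \<open>The rescaled lifts over a parameter rectangle form a parallelogram of null vectors, so
  adjacent sides are orthogonal. The sides do not depend on where they are based, which frees
  \<open>a\<close> and \<open>b\<close>.\<close>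

lemma separable_lift_orthogonal:
  assumes "separable_lift x w" "u \<in> sq" "u' \<in> sq" "a \<in> sq" "v \<in> sq" "v' \<in> sq" "b \<in> sq"
  shows "lor (w u b *\<^sub>R lift (x u b) - w u' b *\<^sub>R lift (x u' b))
             (w a v *\<^sub>R lift (x a v) - w a v' *\<^sub>R lift (x a v')) = 0"
proof -
  have "lor (w u v *\<^sub>R lift (x u v) - w u' v *\<^sub>R lift (x u' v))
            (w u' v *\<^sub>R lift (x u' v) - w u' v' *\<^sub>R lift (x u' v')) = 0"
    by (rule lor_rectangle_orthogonal[OF _ _ _ _ separable_lift_diff[OF assms(1-3,5,6)]])
       (simp_all add: lor_simps)
  moreover have "w u' v *\<^sub>R lift (x u' v) - w u' v' *\<^sub>R lift (x u' v') =
      w a v *\<^sub>R lift (x a v) - w a v' *\<^sub>R lift (x a v')"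
    using separable_lift_diff[OF separable_lift_swap[OF assms(1)] assms(5,6,3,4)] .
  ultimately show ?thesis
    unfolding separable_lift_diff[OF assms(1-3,7,5)] by simp
qed

text \<open>The difference \<open>D\<close> of the rescaled lifts is the same for all
  \<open>u\<close> and stands for a sphere, or for a plane if its first coordinate vanishes. The
  reflection in \<open>D\<close> exchanges two null vectors that differ by \<open>D\<close>.\<close>

lemma gen_inversion_of_separable:
  assumes sep: "separable_lift x w" and v: "v0 \<in> sq" "v1 \<in> sq"
    and u0: "u0 \<in> sq" and ne: "x u0 v0 \<noteq> x u0 v1"
  obtains f where "gen_inversion f" "\<And>u. u \<in> sq \<Longrightarrow> f (Some (x u v0)) = Some (x u v1)"
proof -
  define D where "D = w u0 v1 *\<^sub>R lift (x u0 v1) - w u0 v0 *\<^sub>R lift (x u0 v0)"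
  obtain p d h where Dp: "D = (p, d, h)" by (cases D) auto
  have D: "w u v1 *\<^sub>R lift (x u v1) - w u v0 *\<^sub>R lift (x u v0) = D" if "u \<in> sq" for u
    using separable_lift_diff[OF separable_lift_swap[OF sep] v(2,1) that u0]
    by (simp add: D_def)
  have p: "w u v1 - w u v0 = p"
    and d: "w u v1 *\<^sub>R x u v1 - w u v0 *\<^sub>R x u v0 = d"
    and h: "w u v1 * (x u v1 \<bullet> x u v1) - w u v0 * (x u v0 \<bullet> x u v0) = h" if "u \<in> sq" for u
    using D[OF that] by (simp_all add: Dp lift_def)
  have DD: "lor D D = w u v0 * w u v1 * (norm (x u v0 - x u v1))\<^sup>2" if "u \<in> sq" for u
    unfolding D[OF that, symmetric] by (simp add: lor_simps lor_lift norm_minus_commute)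
  \<comment> \<open>One pair of distinct points suffices for this; as \<open>D\<close> does not
    depend on \<open>u\<close>, the points are then distinct for every \<open>u\<close>.\<close>
  have Dpos: "lor D D > 0"
    using DD[OF u0] separable_lift_pos[OF sep u0] v ne by simp
  have ne': "x u v0 \<noteq> x u v1" if "u \<in> sq" for u
    using DD[OF that] Dpos by auto
  have lorD: "lor D D = d \<bullet> d - p * h" by (simp add: lor_def Dp)
  show thesis
  proof (cases "p = 0")
    case True
    then have d0: "d \<noteq> 0" using Dpos lorD by auto
    have "plane_reflection d (h / 2) (Some (x u v0)) = Some (x u v1)" if u: "u \<in> sq" for u
    proof -
      define w0 where "w0 = w u v0"
      have w0: "w0 > 0" "w u v1 = w0"
        using separable_lift_pos[OF sep u v(1)] p[OF u] True by (auto simp: w0_def)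
      have x1: "x u v1 = x u v0 + d /\<^sub>R w0"
        using d[OF u, symmetric] w0 by (simp add: w0_def[symmetric] scaleR_diff_right[symmetric])
      have "h = w0 * ((x u v0 + d /\<^sub>R w0) \<bullet> (x u v0 + d /\<^sub>R w0) - x u v0 \<bullet> x u v0)"
        using h[OF u] w0 by (simp add: w0_def[symmetric] x1 algebra_simps)
      also have "\<dots> = 2 * (d \<bullet> x u v0) + (d \<bullet> d) / w0"
        using w0 by (simp add: inner_add_left inner_add_right inner_commute field_simps)
      finally have "2 * (d \<bullet> x u v0 - h / 2) / (norm d)\<^sup>2 = - 1 / w0"
        using d0 w0 by (simp add: power2_norm_eq_inner field_simps)
      then show ?thesis
        by (simp add: plane_reflection_def x1 inverse_eq_divide)
    qed
    moreover have "gen_inversion (plane_reflection d (h / 2))"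
      using d0 by (auto simp: gen_inversion_def)
    ultimately show thesis using that by blast
  next
    case False
    \<comment> \<open>Centre and radius of the sphere \<open>lor D (lift y) = 0\<close>.\<close>
    define c where "c = d /\<^sub>R p"
    define r where "r = sqrt (lor D D) / \<bar>p\<bar>"
    have r: "r > 0" "r\<^sup>2 = lor D D / p\<^sup>2"
      using Dpos False by (auto simp: r_def power_divide)
    have "sphere_inversion c r (Some (x u v0)) = Some (x u v1)" if u: "u \<in> sq" for u
    proof -
      define w0 w1 y z where "w0 = w u v0" "w1 = w u v1" "y = x u v0" "z = x u v1"
      note defs = w0_w1_y_z_def
      have w: "w0 > 0" "w1 > 0"
        using separable_lift_pos[OF sep u] v by (auto simp: defs)
      have pc: "p *\<^sub>R c = w1 *\<^sub>R z - w0 *\<^sub>R y" "p = w1 - w0"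
        using d[OF u] p[OF u] False by (simp_all add: c_def defs)
      \<comment> \<open>The centre is collinear with \<open>y\<close> and \<open>z\<close>, and
        \<open>z - c\<close> is \<open>w0 / w1\<close> times \<open>y - c\<close>. It remains to
        recognize this ratio as the factor of the inversion.\<close>
      have yc: "p *\<^sub>R (y - c) = w1 *\<^sub>R (y - z)"
        unfolding scaleR_diff_right pc(1) by (simp add: pc(2) algebra_simps)
      have zc: "p *\<^sub>R (z - c) = w0 *\<^sub>R (y - z)"
        unfolding scaleR_diff_right pc(1) by (simp add: pc(2) algebra_simps)
      have yne: "y \<noteq> c" using yc ne'[OF u] w by (auto simp: defs)
      have "p\<^sup>2 * (norm (y - c))\<^sup>2 = w1\<^sup>2 * (norm (y - z))\<^sup>2"
        using arg_cong[OF yc, of "\<lambda>a. (norm a)\<^sup>2"] by (simp add: power_mult_distrib)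
      then have n: "(norm (y - c))\<^sup>2 = w1\<^sup>2 * (norm (y - z))\<^sup>2 / p\<^sup>2"
        using False by (simp add: field_simps)
      have "r\<^sup>2 / (norm (y - c))\<^sup>2 = w0 / w1"
        unfolding n r(2) DD[OF u] defs[symmetric]
        using ne'[OF u] w False by (simp add: defs[symmetric] power2_eq_square)
      moreover have "(w0 / w1) *\<^sub>R (y - c) = z - c"
      proof -
        have "p *\<^sub>R ((w0 / w1) *\<^sub>R (y - c)) = (w0 / w1) *\<^sub>R (p *\<^sub>R (y - c))"
          by (simp add: mult.commute)
        also have "\<dots> = p *\<^sub>R (z - c)"
          unfolding yc zc using w by simp
        finally show ?thesis using False by (simp only: scaleR_cancel_left) auto
      qed
      ultimately show ?thesis
        using yne by (simp add: sphere_inversion_def defs[symmetric])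
    qed
    moreover have "gen_inversion (sphere_inversion c r)"
      using r by (auto simp: gen_inversion_def)
    ultimately show thesis using that by blast
  qed
qed

lemma span_pair: "z \<in> span {p, q} \<longleftrightarrow> (\<exists>\<alpha> \<beta>. z = \<alpha> *\<^sub>R p + \<beta> *\<^sub>R q)"
  by (simp add: span_breakdown_eq span_singleton image_iff diff_eq_eq add.commute)

text \<open>The point at infinity pairs with every lift to a nonzero number, and two lifts are
  orthogonal only if their points coincide.\<close>

lemma lor_null_proportional:
  assumes "lor N N = 0" "N \<noteq> 0" "lor N (lift y) = 0"
  obtains r where "r \<noteq> 0" "N = r *\<^sub>R lift y"
  using assms(1,2)
proof (cases rule: lor_null_cases)
  case (1 h)
  then show thesis using assms(3) by (simp add: lor_def lift_def)
next
  case (2 r c)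
  then show thesis using assms(3) that by (simp add: lor_simps lor_lift)
qed

section \<open>Moving a null vector to infinity, and the normal forms reached in this way\<close>

lemma C1_inversion:
  fixes \<gamma> :: "real \<Rightarrow> 'a::real_inner"
  assumes "\<gamma> C1_differentiable_on UNIV" "\<And>t. \<gamma> t \<noteq> c"
  shows "(\<lambda>t. c + (1 / (norm (\<gamma> t - c))\<^sup>2) *\<^sub>R (\<gamma> t - c)) C1_differentiable_on UNIV"
proof -
  obtain D where D: "\<And>t. (\<gamma> has_vector_derivative D t) (at t)" "continuous_on UNIV D"
    using assms(1) unfolding C1_differentiable_on_def by blast
  have cont: "continuous_on UNIV \<gamma>"
    using D(1) by (meson continuous_at_imp_continuous_on has_vector_derivative_continuous)
  have ne: "(\<gamma> t - c) \<bullet> (\<gamma> t - c) \<noteq> 0" for t using assms(2) by simp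
  have "((\<lambda>t. inverse ((\<gamma> t - c) \<bullet> (\<gamma> t - c))) has_vector_derivative
      (- 2 * ((\<gamma> t - c) \<bullet> D t) / ((\<gamma> t - c) \<bullet> (\<gamma> t - c))\<^sup>2)) (at t)" for t
    using D(1)[of t] ne[of t] unfolding has_vector_derivative_def
    by (auto intro!: derivative_eq_intros simp: inner_commute fun_eq_iff field_simps power2_eq_square)
  then have "(\<lambda>t. inverse ((\<gamma> t - c) \<bullet> (\<gamma> t - c))) C1_differentiable_on UNIV"
    unfolding C1_differentiable_on_def
    by (intro exI conjI ballI, assumption) (use ne in \<open>auto intro!: continuous_intros cont D(2)\<close>)
  then have "(\<lambda>t. c + inverse ((\<gamma> t - c) \<bullet> (\<gamma> t - c)) *\<^sub>R (\<gamma> t - c)) C1_differentiable_on UNIV"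
    by (intro derivative_intros assms(1))
  then show ?thesis by (simp add: power2_norm_eq_inner inverse_eq_divide)
qed

text \<open>The identity serves if \<open>N\<close> is at infinity already, and the unit inversion
  about \<open>c\<close> if \<open>N\<close> is the point \<open>c\<close>. \<open>L\<close> is the
  linear isometry induced on lifts, up to the positive factor \<open>\<mu>\<close>. The condition
  \<open>lor N (lift y) \<noteq> 0\<close> keeps \<open>y\<close> off the point that goes to
  infinity.\<close>

lemma mobius_sending_null_to_infinity:
  assumes "lor N N = 0" "N \<noteq> 0"
  obtains m M L h where "mobius m" "linear L" "\<forall>a b. lor (L a) (L b) = lor a b"
    "h \<noteq> 0" "L N = (0, 0, h)"
    "\<forall>y. lor N (lift y) \<noteq> 0 \<longrightarrow>
      m (Some y) = Some (M y) \<and> (\<exists>\<mu>>0. L (lift y) = \<mu> *\<^sub>R lift (M y))"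
    "\<forall>\<gamma>. \<gamma> C1_differentiable_on UNIV \<longrightarrow> (\<forall>t. lor N (lift (\<gamma> t)) \<noteq> 0) \<longrightarrow>
      (\<lambda>t. M (\<gamma> t)) C1_differentiable_on UNIV"
  using assms
proof (cases rule: lor_null_cases)
  case (1 h)
  then show thesis
    using mobius_id by (intro that[of id id h id]) (auto simp: linear_id intro: exI[of _ 1])
next
  case (2 r c)
  \<comment> \<open>\<open>P\<close> is -2 times the pairing with \<open>lift c\<close>, so
    \<open>P (lift y)\<close> is the squared distance of \<open>y\<close> from \<open>c\<close>.
    \<open>L\<close> is the linear map with
    \<open>L (lift y) = P (lift y) *\<^sub>R lift (M y)\<close> for
    \<open>y \<noteq> c\<close>.\<close>
  define P where "P a = snd (snd a) - 2 * (c \<bullet> fst (snd a)) + fst a * (c \<bullet> c)" for a :: lvec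
  define L :: "lvec \<Rightarrow> lvec" where
    "L a = (P a, P a *\<^sub>R c + fst (snd a) - fst a *\<^sub>R c,
            P a * (c \<bullet> c) + 2 * (c \<bullet> fst (snd a)) - 2 * fst a * (c \<bullet> c) + fst a)" for a
  define M where "M y = c + (1 / (norm (y - c))\<^sup>2) *\<^sub>R (y - c)" for y
  have ne: "y \<noteq> c" if "lor N (lift y) \<noteq> 0" for y
    using that 2 by (auto simp: lor_simps)
  show thesis
  proof (rule that[of "sphere_inversion c 1 \<circ> id" L r M]; (intro allI impI conjI)?)
    show "mobius (sphere_inversion c 1 \<circ> id)"
      by (intro mobius_comp mobius_id) (unfold gen_inversion_def, use zero_less_one in blast)
    show "linear L"
      by (rule linearI) (auto simp: L_def P_def algebra_simps)
    show "lor (L a) (L b) = lor a b" for a b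
      by (simp add: L_def P_def lor_def inner_add_left inner_add_right inner_diff_left
          inner_diff_right inner_commute field_simps)
    show "L N = (0, 0, r)" using 2 by (simp add: L_def P_def lift_def)
    show "(sphere_inversion c 1 \<circ> id) (Some y) = Some (M y)" if "lor N (lift y) \<noteq> 0" for y
      using ne[OF that] by (simp add: sphere_inversion_def M_def)
    show "\<exists>\<mu>>0. L (lift y) = \<mu> *\<^sub>R lift (M y)" if "lor N (lift y) \<noteq> 0" for y
    proof (intro exI conjI)
      have P: "P (lift y) = (norm (y - c))\<^sup>2"
        by (simp add: P_def lift_def power2_norm_eq_inner inner_diff_left inner_diff_right inner_commute)
      show pos: "P (lift y) > 0" using ne[OF that] by (simp add: P)
      have *: "(y - c) \<bullet> (y - c) = P (lift y)" by (simp add: P power2_norm_eq_inner)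
      have M: "M y = c + inverse (P (lift y)) *\<^sub>R (y - c)"
        by (simp add: M_def P inverse_eq_divide)
      have **: "k * ((c + inverse k *\<^sub>R z) \<bullet> (c + inverse k *\<^sub>R z)) = k * (c \<bullet> c) + 2 * (c \<bullet> z) + 1"
        if "k > 0" "z \<bullet> z = k" for k and z :: "real^3"
        using that by (simp add: inner_add_left inner_add_right inner_commute[of z c] field_simps)
      have MM: "P (lift y) * (M y \<bullet> M y) = P (lift y) * (c \<bullet> c) + 2 * (c \<bullet> (y - c)) + 1"
        unfolding M by (rule **[OF pos *])
      have PM: "P (lift y) *\<^sub>R M y = P (lift y) *\<^sub>R c + (y - c)"
        unfolding M using pos by (simp add: scaleR_add_right)
      show "L (lift y) = P (lift y) *\<^sub>R lift (M y)"
        unfolding L_def by (simp add: lift_def[of "M y"] MM PM) (simp add: lift_def inner_diff_right)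
    qed
    show "(\<lambda>t. M (\<gamma> t)) C1_differentiable_on UNIV"
      if "\<gamma> C1_differentiable_on UNIV" "\<forall>t. lor N (lift (\<gamma> t)) \<noteq> 0" for \<gamma>
      unfolding M_def using that ne by (intro C1_inversion) auto
  qed (use 2 in auto)
qed

text \<open>With first coordinate 0, \<open>p\<close> and \<open>q\<close> are two perpendicular
  planes that meet in the axis. The span condition makes the weight constant along a
  \<open>u\<close>-line, keeps displacements normal to the axis and preserves the distance to a
  point of it; so the line lies on a circle about the axis.\<close>

lemma in_surface_of_revolution:
  assumes w: "\<And>u v. u \<in> sq \<Longrightarrow> v \<in> sq \<Longrightarrow> w u v > 0"
    and span: "\<And>u v. u \<in> sq \<Longrightarrow> v \<in> sq \<Longrightarrow>
      w u v *\<^sub>R lift (y u v) - w 0 v *\<^sub>R lift (y 0 v) \<in> span {p, q}"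
    and pq: "fst p = 0" "fst q = 0" "lor p p > 0" "lor q q > 0" "lor p q = 0"
    and g: "g C1_differentiable_on UNIV" "range g = y 0 ` sq"
  shows "\<exists>S. surface_of_revolution S \<and> (\<forall>u\<in>sq. \<forall>v\<in>sq. y u v \<in> S)"
proof -
  obtain e1 m1 where p: "p = (0, e1, m1)" using pq(1) by (cases p) auto
  obtain e2 m2 where q: "q = (0, e2, m2)" using pq(2) by (cases q) auto
  have e12: "e1 \<bullet> e1 > 0" "e2 \<bullet> e2 > 0" "e1 \<bullet> e2 = 0"
    using pq by (auto simp: p q lor_def)
  define e where "e = cross3 e1 e2"
  \<comment> \<open>The common point of the planes \<open>2 * (e1 \<bullet> y) = m1\<close> and
    \<open>2 * (e2 \<bullet> y) = m2\<close> that lies in the span of their normals.\<close>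
  define a where "a = (m1 / (2 * (e1 \<bullet> e1))) *\<^sub>R e1 + (m2 / (2 * (e2 \<bullet> e2))) *\<^sub>R e2"
  have a: "2 * (e1 \<bullet> a) = m1" "2 * (e2 \<bullet> a) = m2"
    using e12 by (simp_all add: a_def inner_add_right inner_commute[of e2 e1])
  have ee: "e1 \<bullet> e = 0" "e2 \<bullet> e = 0" by (simp_all add: e_def dot_cross_self)
  have e0: "e \<noteq> 0"
    using norm_cross_dot[of e1 e2] e12 by (auto simp: e_def)
  let ?h = "\<lambda>y. (y - a) \<bullet> e"
  let ?n = "\<lambda>y. norm ((y - a) - (?h y / (e \<bullet> e)) *\<^sub>R e)"
  define S where "S = {y. \<exists>t. ?h y = ?h (g t) \<and> ?n y = ?n (g t)}"
  have "surface_of_revolution S"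
    unfolding surface_of_revolution_def S_def using e0 g(1) by blast
  moreover have "y u v \<in> S" if u: "u \<in> sq" and v: "v \<in> sq" for u v
  proof -
    obtain \<alpha> \<beta> where *: "w u v *\<^sub>R lift (y u v) - w 0 v *\<^sub>R lift (y 0 v) = \<alpha> *\<^sub>R p + \<beta> *\<^sub>R q"
      using span[OF u v] by (auto simp: span_pair)
    define c z z' where "c = w u v" "z = y u v" "z' = y 0 v"
    note defs = c_z_z'_def
    have c: "c > 0" using w[OF u v] by (simp add: defs)
    \<comment> \<open>First coordinates are compared here; \<open>p\<close> and \<open>q\<close>
      contribute nothing to them.\<close>
    have "w 0 v = c" using * by (simp add: lift_def p q defs)
    then have d: "c *\<^sub>R (z - z') = \<alpha> *\<^sub>R e1 + \<beta> *\<^sub>R e2"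
      and s: "c * (z \<bullet> z - z' \<bullet> z') = \<alpha> * m1 + \<beta> * m2"
      using * by (simp_all add: lift_def p q defs algebra_simps)
    have "c * ((z - z') \<bullet> e) = (c *\<^sub>R (z - z')) \<bullet> e" by simp
    also have "\<dots> = 0" unfolding d by (simp add: inner_add_left ee)
    finally have h: "?h z = ?h z'" using c by (simp add: inner_diff_left)
    have "c * ((z - a) \<bullet> (z - a) - (z' - a) \<bullet> (z' - a)) =
        c * (z \<bullet> z - z' \<bullet> z') - 2 * ((c *\<^sub>R (z - z')) \<bullet> a)"
      by (simp add: inner_diff_left inner_diff_right inner_commute algebra_simps)
    also have "\<dots> = 0" unfolding d s by (simp add: inner_add_left a[symmetric] algebra_simps)
    finally have zz: "(z - a) \<bullet> (z - a) = (z' - a) \<bullet> (z' - a)" using c by simp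
    \<comment> \<open>Pythagoras: equal height and equal distance from \<open>a\<close> give equal
      distance from the axis.\<close>
    have nn: "(?n b)\<^sup>2 = (b - a) \<bullet> (b - a) - (?h b)\<^sup>2 / (e \<bullet> e)" for b
      unfolding power2_norm_eq_inner using e0
      by (simp add: inner_diff_left[of "b - a"] inner_diff_right[of _ "b - a"] inner_commute[of e "b - a"]
          power2_eq_square)
    have "(?n z)\<^sup>2 = (?n z')\<^sup>2" using nn[of z] nn[of z'] zz h by metis
    then have n: "?n z = ?n z'" by (simp add: power2_eq_iff_nonneg)
    obtain t where t: "g t = z'" using g(2) v unfolding defs by (metis imageI imageE)
    have "z \<in> S" unfolding S_def mem_Collect_eq by (intro exI[of _ t] conjI; unfold t; fact)
    then show ?thesis by (simp add: defs)
  qed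
  ultimately show ?thesis by blast
qed

text \<open>The vector \<open>(0, 0, h)\<close> affects only the last coordinate, so the first two
  coordinates of a \<open>u\<close>-difference are multiples of those of \<open>p\<close>. For
  \<open>p0 = 0\<close> the points move in direction \<open>e\<close>; otherwise they move on lines
  through the apex \<open>e / p0\<close>.\<close>

lemma in_gen_cone_or_cylinder:
  assumes w: "\<And>u v. u \<in> sq \<Longrightarrow> v \<in> sq \<Longrightarrow> w u v > 0"
    and span: "\<And>u v. u \<in> sq \<Longrightarrow> v \<in> sq \<Longrightarrow>
      w u v *\<^sub>R lift (y u v) - w 0 v *\<^sub>R lift (y 0 v) \<in> span {(0, 0, h), p}"
    and p: "lor p p \<noteq> 0"
    and g: "g C1_differentiable_on UNIV" "range g = y 0 ` sq"
  shows "\<exists>S. (gen_cone S \<or> gen_cylinder S) \<and> (\<forall>u\<in>sq. \<forall>v\<in>sq. y u v \<in> S)"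
proof -
  obtain p0 e k where pp: "p = (p0, e, k)" by (cases p) auto
  have comb: "\<exists>\<alpha>. w u v - w 0 v = \<alpha> * p0 \<and> w u v *\<^sub>R y u v - w 0 v *\<^sub>R y 0 v = \<alpha> *\<^sub>R e"
    if "u \<in> sq" "v \<in> sq" for u v
    using span[OF that] by (auto simp: span_pair pp lift_def)
  have 0: "0 \<in> sq" by (simp add: sq_def)
  have gt: "\<exists>t. g t = y 0 v" if "v \<in> sq" for v
    using g(2) that by (metis imageI imageE)
  show ?thesis
  proof (cases "p0 = 0")
    case True
    then have e: "e \<noteq> 0" using p by (auto simp: pp lor_def)
    let ?S = "{g t + s *\<^sub>R e | s t. True}"
    have "gen_cylinder ?S" using e g(1) unfolding gen_cylinder_def by blast
    moreover have "y u v \<in> ?S" if u: "u \<in> sq" and v: "v \<in> sq" for u v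
    proof -
      obtain \<alpha> where \<alpha>: "w u v - w 0 v = \<alpha> * p0" "w u v *\<^sub>R y u v - w 0 v *\<^sub>R y 0 v = \<alpha> *\<^sub>R e"
        using comb[OF u v] by auto
      have "w u v *\<^sub>R (y u v - y 0 v) = \<alpha> *\<^sub>R e"
        using \<alpha> True by (simp add: scaleR_diff_right)
      then have "y u v - y 0 v = (\<alpha> / w u v) *\<^sub>R e"
        using w[OF u v] by (simp add: eq_vector_fraction_iff)
      then have y: "y u v = y 0 v + (\<alpha> / w u v) *\<^sub>R e" by (simp add: algebra_simps)
      obtain t where t: "g t = y 0 v" using gt[OF v] by blast
      show ?thesis unfolding y t[symmetric] by blast
    qed
    ultimately show ?thesis by blast
  next
    case False
    define c where "c = e /\<^sub>R p0"
    let ?S = "{c + s *\<^sub>R (g t - c) | s t. True}"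
    have "gen_cone ?S" using g(1) unfolding gen_cone_def by blast
    moreover have "y u v \<in> ?S" if u: "u \<in> sq" and v: "v \<in> sq" for u v
    proof -
      obtain \<alpha> where \<alpha>: "w u v - w 0 v = \<alpha> * p0" "w u v *\<^sub>R y u v - w 0 v *\<^sub>R y 0 v = \<alpha> *\<^sub>R e"
        using comb[OF u v] by auto
      have "\<alpha> *\<^sub>R e = (w u v - w 0 v) *\<^sub>R c" using False by (simp add: c_def \<alpha>(1))
      then have "w u v *\<^sub>R (y u v - c) = w 0 v *\<^sub>R (y 0 v - c)"
        using \<alpha>(2) by (simp add: algebra_simps)
      then have "y u v - c = (w 0 v / w u v) *\<^sub>R (y 0 v - c)"
        using w[OF u v] by (simp add: eq_vector_fraction_iff)
      then have y: "y u v = c + (w 0 v / w u v) *\<^sub>R (y 0 v - c)" by (simp add: algebra_simps)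
      obtain t where t: "g t = y 0 v" using gt[OF v] by blast
      show ?thesis unfolding y t[symmetric] by blast
    qed
    ultimately show ?thesis by blast
  qed
qed

lemma lor_scaled_lift_diff:
  "lor (a *\<^sub>R lift y - b *\<^sub>R lift z) (a *\<^sub>R lift y - b *\<^sub>R lift z) = a * b * (norm (y - z))\<^sup>2"
  by (simp add: lor_simps lor_lift norm_minus_commute)

text \<open>A dependence would write \<open>lift z\<close> as a combination of the other two lifts.
  Its norm contains the factor \<open>r * (1 - r)\<close>, so nullity would make \<open>z\<close>
  one of the first two points.\<close>

lemma scaled_lift_diff_independent:
  assumes "a > 0" "b > 0" "c > 0" "x \<noteq> y" "x \<noteq> z" "y \<noteq> z"
  shows "c *\<^sub>R lift z - a *\<^sub>R lift x \<noteq> r *\<^sub>R (b *\<^sub>R lift y - a *\<^sub>R lift x)"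
proof
  assume *: "c *\<^sub>R lift z - a *\<^sub>R lift x = r *\<^sub>R (b *\<^sub>R lift y - a *\<^sub>R lift x)"
  then have z: "c *\<^sub>R lift z = (r * b) *\<^sub>R lift y + ((1 - r) * a) *\<^sub>R lift x"
    by (simp add: algebra_simps)
  have "lor (c *\<^sub>R lift z) (c *\<^sub>R lift z) = - r * (1 - r) * (a * b) * (norm (x - y))\<^sup>2"
    unfolding z by (simp add: lor_simps lor_lift norm_minus_commute)
  then have "r * (1 - r) = 0" using assms by (simp add: lor_simps)
  then consider "r = 0" | "r = 1" by auto
  then show False
    using z assms by cases (auto simp: lift_def)
qed

lemma span_two_dim:
  fixes p q :: "'a::euclidean_space"
  assumes "dim U \<le> 2" "p \<in> U" "q \<in> U" "p \<noteq> 0" "\<And>r. q \<noteq> r *\<^sub>R p"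
  shows "U \<subseteq> span {p, q}"
proof (rule card_ge_dim_independent)
  have "q \<notin> span {p}" using assms(5) by (auto simp: span_singleton)
  then show "independent {p, q}"
    using assms(4) by (subst insert_commute) (simp add: independent_insert)
  show "dim U \<le> card {p, q}" using assms(1) assms(5)[of 1] by (auto simp: card_insert_if)
qed (use assms in auto)

lemma lor_span_pair_zero:
  assumes "lor p b = 0" "lor q b = 0" "z \<in> span {p, q}"
  shows "lor z b = 0"
  using assms by (auto simp: span_pair lor_simps)

section \<open>Classification of separable lifts\<close>

text \<open>Three distinct points of one \<open>u\<close>-line provide a basis of the plane of
  \<open>u\<close>-differences, with a vector of positive norm in it; the signature of the plane
  decides the type of the surface. The hypotheses \<open>ncu\<close> and \<open>ncv\<close> keep the
  point moved to infinity off the surface.\<close>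

lemma mobius_of_separable_dim2:
  assumes sep: "separable_lift x w"
    and g: "g C1_differentiable_on UNIV" "range g = x 0 ` sq"
    and ncu: "\<And>u v. u \<in> sq \<Longrightarrow> v \<in> sq \<Longrightarrow> \<exists>u'\<in>sq. x u' v \<noteq> x u v"
    and ncv: "\<And>u v. u \<in> sq \<Longrightarrow> v \<in> sq \<Longrightarrow> \<exists>v'\<in>sq. x u v' \<noteq> x u v"
    and three: "u1 \<in> sq" "u2 \<in> sq" "x 0 0 \<noteq> x u1 0" "x 0 0 \<noteq> x u2 0" "x u1 0 \<noteq> x u2 0"
    and dim: "dim ((\<lambda>u. w u 0 *\<^sub>R lift (x u 0) - w 0 0 *\<^sub>R lift (x 0 0)) ` sq) \<le> 2"
  shows "\<exists>m S. mobius m \<and> (surface_of_revolution S \<or> gen_cone S \<or> gen_cylinder S) \<and>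
          (\<forall>u\<in>sq. \<forall>v\<in>sq. m (Some (x u v)) \<in> Some ` S)"
proof -
  define F where "F u v = w u v *\<^sub>R lift (x u v)" for u v
  have 0: "0 \<in> sq" by (simp add: sq_def)
  have pos: "w u v > 0" if "u \<in> sq" "v \<in> sq" for u v
    using separable_lift_pos[OF sep that] .
  have FF: "lor (F u v) (F u' v') = - w u v * w u' v' * (norm (x u v - x u' v'))\<^sup>2 / 2" for u v u' v'
    by (simp add: F_def lor_simps lor_lift)
  have null: "lor (F u v) (F u v) = 0" for u v by (simp add: FF)
  define p where "p = F u1 0 - F 0 0"
  define q where "q = F u2 0 - F 0 0"
  have pp: "lor p p > 0"
    using three pos[OF 0 0] pos[OF three(1) 0]
    by (simp add: p_def F_def lor_scaled_lift_diff)
  have p0: "p \<noteq> 0" using pp by auto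
  have indep: "q \<noteq> r *\<^sub>R p" for r
    unfolding p_def q_def F_def
    by (rule scaled_lift_diff_independent) (use three pos 0 in auto)
  have "(\<lambda>u. F u 0 - F 0 0) ` sq \<subseteq> span {p, q}"
    by (rule span_two_dim) (use dim three(1,2) p0 indep in \<open>auto simp: p_def q_def F_def\<close>)
  then have U: "F u v - F 0 v \<in> span {p, q}" if "u \<in> sq" "v \<in> sq" for u v
    using separable_lift_diff[OF sep that(1) 0 that(2) 0] that by (auto simp: F_def)
  have orth: "lor z (F u v - F u v') = 0" if "z \<in> span {p, q}" "u \<in> sq" "v \<in> sq" "v' \<in> sq" for z u v v'
    by (rule lor_span_pair_zero[OF _ _ that(1)])
       (use separable_lift_orthogonal[OF sep _ 0 that(2-4) 0] three(1,2) in \<open>auto simp: p_def q_def F_def\<close>)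
  \<comment> \<open>Moves the whole configuration: \<open>y\<close> is the image patch, and
    \<open>w'\<close> is the weight for which \<open>L\<close> maps rescaled lifts to rescaled
    lifts. Span relations and pairings then pass to the image along \<open>L\<close>.\<close>
  have transport: "\<exists>m y w' L h g'. mobius m \<and> linear L \<and> (\<forall>a b. lor (L a) (L b) = lor a b) \<and>
      h \<noteq> 0 \<and> L N = (0, 0, h) \<and>
      (\<forall>u\<in>sq. \<forall>v\<in>sq. w' u v > 0 \<and> m (Some (x u v)) = Some (y u v) \<and>
         L (F u v) = w' u v *\<^sub>R lift (y u v)) \<and>
      g' C1_differentiable_on UNIV \<and> range g' = y 0 ` sq"
    if N: "lor N N = 0" "N \<noteq> 0" and Nx: "\<forall>u\<in>sq. \<forall>v\<in>sq. lor N (lift (x u v)) \<noteq> 0"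
    for N
  proof -
    obtain m M L h where L: "mobius m" "linear L" "\<forall>a b. lor (L a) (L b) = lor a b"
        "h \<noteq> 0" "L N = (0, 0, h)"
      and mM: "\<forall>y. lor N (lift y) \<noteq> 0 \<longrightarrow>
        m (Some y) = Some (M y) \<and> (\<exists>\<mu>>0. L (lift y) = \<mu> *\<^sub>R lift (M y))"
      and C1: "\<forall>\<gamma>. \<gamma> C1_differentiable_on UNIV \<longrightarrow> (\<forall>t. lor N (lift (\<gamma> t)) \<noteq> 0) \<longrightarrow>
        (\<lambda>t. M (\<gamma> t)) C1_differentiable_on UNIV"
      by (rule mobius_sending_null_to_infinity[OF N])
    have "\<forall>y. \<exists>\<mu>. lor N (lift y) \<noteq> 0 \<longrightarrow> \<mu> > 0 \<and> L (lift y) = \<mu> *\<^sub>R lift (M y)"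
      using mM by blast
    then obtain \<mu> where \<mu>: "\<And>y. lor N (lift y) \<noteq> 0 \<Longrightarrow> \<mu> y > 0 \<and> L (lift y) = \<mu> y *\<^sub>R lift (M y)"
      using choice[of "\<lambda>y \<mu>. lor N (lift y) \<noteq> 0 \<longrightarrow> \<mu> > 0 \<and> L (lift y) = \<mu> *\<^sub>R lift (M y)"] by blast
    have gx: "\<exists>v\<in>sq. g t = x 0 v" for t using g(2) by (metis imageE rangeI)
    have c1: "(\<lambda>t. M (g t)) C1_differentiable_on UNIV"
      using C1 g(1) gx Nx 0 by metis
    have c2: "range (\<lambda>t. M (g t)) = (\<lambda>v. M (x 0 v)) ` sq"
      using g(2) by (metis image_image)
    have c3: "\<forall>u\<in>sq. \<forall>v\<in>sq. w u v * \<mu> (x u v) > 0 \<and> m (Some (x u v)) = Some (M (x u v)) \<and>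
         L (F u v) = (w u v * \<mu> (x u v)) *\<^sub>R lift (M (x u v))"
      using pos \<mu> mM Nx by (auto simp: F_def linear_cmul[OF L(2)])
    show ?thesis
      by (intro exI[of _ m] exI[of _ "\<lambda>u v. M (x u v)"] exI[of _ "\<lambda>u v. w u v * \<mu> (x u v)"]
          exI[of _ L] exI[of _ h] exI[of _ "\<lambda>t. M (g t)"] conjI) (fact L c1 c2 c3)+
  qed
  have Lspan: "L z \<in> span {L a, L b}" if "linear L" "z \<in> span {a, b}" for L :: "lvec \<Rightarrow> lvec" and z a b
    using that linear_span_image[OF that(1), of "{a, b}"] by auto
  show ?thesis
  proof (cases "\<exists>N\<in>span {p, q}. N \<noteq> 0 \<and> lor N N = 0")
    case True
    then obtain N where N: "N \<in> span {p, q}" "N \<noteq> 0" "lor N N = 0" by blast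
    obtain \<alpha> \<beta> where ab: "N = \<alpha> *\<^sub>R p + \<beta> *\<^sub>R q" using N(1) by (auto simp: span_pair)
    \<comment> \<open>As \<open>p\<close> is not null, \<open>N\<close> involves \<open>q\<close>
      and can replace it in the basis.\<close>
    have "\<beta> \<noteq> 0" using N(2,3) pp by (auto simp: ab lor_simps)
    then have "q = (1 / \<beta>) *\<^sub>R N + (- \<alpha> / \<beta>) *\<^sub>R p"
      by (simp add: ab algebra_simps)
    then have "q \<in> span {N, p}" unfolding span_pair by blast
    moreover have "p \<in> span {N, p}" by (simp add: span_base)
    ultimately have sub: "span {p, q} \<subseteq> span {N, p}"
      by (intro span_minimal) auto
    \<comment> \<open>\<open>N\<close> is orthogonal to all \<open>v\<close>-differences, whereas
      the lift of a point has a nonzero product with the difference to any other point of its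
      \<open>v\<close>-line.\<close>
    have Nx: "lor N (lift (x u v)) \<noteq> 0" if uv: "u \<in> sq" "v \<in> sq" for u v
    proof
      assume "lor N (lift (x u v)) = 0"
      then obtain r where r: "r \<noteq> 0" "N = r *\<^sub>R lift (x u v)"
        using lor_null_proportional[OF N(3,2)] by blast
      obtain v' where v': "v' \<in> sq" "x u v' \<noteq> x u v" using ncv[OF uv] by blast
      have "lor N (F u v' - F u v) = 0" by (rule orth[OF N(1) uv(1) v'(1) uv(2)])
      then show False using v' r pos[OF uv(1) v'(1)]
        by (simp add: F_def lor_simps lor_lift)
    qed
    have "\<forall>u\<in>sq. \<forall>v\<in>sq. lor N (lift (x u v)) \<noteq> 0" using Nx by blast
    from transport[OF N(3,2) this] obtain m y w' L h g' where
      L: "mobius m" "linear L" "\<forall>a b. lor (L a) (L b) = lor a b" "h \<noteq> 0" "L N = (0, 0, h)"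
      and *: "\<forall>u\<in>sq. \<forall>v\<in>sq. w' u v > 0 \<and> m (Some (x u v)) = Some (y u v) \<and>
         L (F u v) = w' u v *\<^sub>R lift (y u v)"
      and g': "g' C1_differentiable_on UNIV" "range g' = y 0 ` sq"
      by (elim exE conjE) (rule that)
    have iso: "lor (L a) (L b) = lor a b" for a b using L(3) by blast
    have y: "w' u v > 0" "m (Some (x u v)) = Some (y u v)" "L (F u v) = w' u v *\<^sub>R lift (y u v)"
      if "u \<in> sq" "v \<in> sq" for u v
      using * that by auto
    have "\<exists>S. (gen_cone S \<or> gen_cylinder S) \<and> (\<forall>u\<in>sq. \<forall>v\<in>sq. y u v \<in> S)"
    proof (rule in_gen_cone_or_cylinder[where w = w' and y = y and g = g'])
      show "w' u v *\<^sub>R lift (y u v) - w' 0 v *\<^sub>R lift (y 0 v) \<in> span {(0, 0, h), L p}"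
        if "u \<in> sq" "v \<in> sq" for u v
        using Lspan[OF L(2), of "F u v - F 0 v" N p] U[OF that] sub that 0 L(5)
        by (auto simp: y(3) linear_diff[OF L(2)])
      show "lor (L p) (L p) \<noteq> 0" using pp iso by simp
    qed (fact y g')+
    then obtain S where S: "gen_cone S \<or> gen_cylinder S" "\<And>u v. u \<in> sq \<Longrightarrow> v \<in> sq \<Longrightarrow> y u v \<in> S"
      by blast
    then show ?thesis using L(1) y(2) by (intro exI[of _ m] exI[of _ S]) auto
  next
    case False
    \<comment> \<open>Gram-Schmidt. If \<open>r\<close> had negative norm, the line through
      \<open>p\<close> in direction \<open>r\<close> would contain a null vector of the
      plane.\<close>
    define r where "r = q - (lor p q / lor p p) *\<^sub>R p"
    have rs: "r \<in> span {p, q}"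
      unfolding span_pair r_def by (intro exI[of _ "- lor p q / lor p p"] exI[of _ 1]) simp
    have pr: "lor p r = 0" using pp by (simp add: r_def lor_simps)
    have "q = (lor p q / lor p p) *\<^sub>R p + 1 *\<^sub>R r" by (simp add: r_def)
    then have "q \<in> span {p, r}" unfolding span_pair by blast
    moreover have "p \<in> span {p, r}" by (simp add: span_base)
    ultimately have sub: "span {p, q} \<subseteq> span {p, r}" by (intro span_minimal) auto
    have ps: "p \<in> span {p, q}" by (simp add: span_base)
    have r0: "r \<noteq> 0" using indep by (auto simp: r_def)
    have rr: "lor r r > 0"
    proof (rule ccontr)
      assume "\<not> lor r r > 0"
      moreover have "lor r r \<noteq> 0" using False rs r0 by blast
      ultimately have "lor r r < 0" by simp
      then obtain k where k: "lor (p + k *\<^sub>R r) (p + k *\<^sub>R r) = 0"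
        using lor_null_on_line[OF pp] by blast
      have "p + k *\<^sub>R r \<in> span {p, q}" by (intro span_add span_scale ps rs)
      then have "p + k *\<^sub>R r = 0" using False k by blast
      then have "lor (p + k *\<^sub>R r) p = 0" by simp
      then show False using pp pr by (simp add: lor_simps lor_commute[of r])
    qed
    \<comment> \<open>The component of the null vector \<open>F 0 0\<close> orthogonal to the plane.
      Its norm is minus that of the removed component, which is positive because
      \<open>lor (F 0 0) p\<close> does not vanish.\<close>
    define G where "G = F 0 0 - (lor (F 0 0) p / lor p p) *\<^sub>R p - (lor (F 0 0) r / lor r r) *\<^sub>R r"
    have Gp: "lor p G = 0" and Gr: "lor r G = 0"
      using pp rr pr by (simp_all add: G_def lor_simps lor_commute[of _ "F 0 0"] lor_commute[of r p])
    have "lor G G = lor (F 0 0) G"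
      by (subst (1) G_def) (simp add: lor_simps Gp Gr)
    also have "\<dots> = - ((lor (F 0 0) p)\<^sup>2 / lor p p + (lor (F 0 0) r)\<^sup>2 / lor r r)"
      by (simp add: G_def lor_simps null power2_eq_square)
    finally have GG: "lor G G = - ((lor (F 0 0) p)\<^sup>2 / lor p p + (lor (F 0 0) r)\<^sup>2 / lor r r)" .
    have "lor (F 0 0) p \<noteq> 0"
      using pos[OF 0 0] pos[OF three(1) 0] three(3) by (simp add: p_def lor_simps FF)
    then have "(lor (F 0 0) p)\<^sup>2 / lor p p > 0" "(lor (F 0 0) r)\<^sup>2 / lor r r \<ge> 0"
      using pp rr by simp_all
    then have GG: "lor G G < 0" unfolding GG by simp
    obtain v1 where v1: "v1 \<in> sq" "x 0 v1 \<noteq> x 0 0" using ncv[OF 0 0] by blast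
    \<comment> \<open>This \<open>v\<close>-difference is orthogonal to the plane like
      \<open>G\<close>, but has positive norm. So the line through \<open>d\<close> in direction
      \<open>G\<close> contains a null vector \<open>N\<close> of the complement, a point common to
      the spheres \<open>p\<close> and \<open>r\<close>.\<close>
    define d where "d = F 0 v1 - F 0 0"
    have dd: "lor d d > 0"
      using v1 pos[OF 0 0] pos[OF 0 v1(1)] by (simp add: d_def F_def lor_scaled_lift_diff)
    obtain k where k: "lor (d + k *\<^sub>R G) (d + k *\<^sub>R G) = 0"
      using lor_null_on_line[OF dd GG] by blast
    define N where "N = d + k *\<^sub>R G"
    have Nn: "lor N N = 0" using k by (simp add: N_def)
    \<comment> \<open>The norms of \<open>d\<close> and \<open>G\<close> have opposite signs, so
      \<open>d\<close> is no multiple of \<open>G\<close>.\<close>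
    have N0: "N \<noteq> 0"
    proof
      assume "N = 0"
      then have "d = (- k) *\<^sub>R G" by (simp add: N_def eq_neg_iff_add_eq_0)
      then have "lor d d = k\<^sup>2 * lor G G" by (simp only: lor_simps) (simp add: power2_eq_square)
      then show False using dd GG by (metis mult_nonneg_nonpos less_imp_le not_le zero_le_power2)
    qed
    have dz: "lor z d = 0" if "z \<in> span {p, q}" for z
      unfolding d_def by (rule orth[OF that 0 v1(1) 0])
    have zN: "lor z N = 0" if "z \<in> span {p, q}" for z
    proof (rule lor_span_pair_zero[of p _ r])
      show "lor p N = 0" "lor r N = 0"
        using dz[OF ps] dz[OF rs] Gp Gr by (simp_all add: N_def lor_simps)
    qed (use that sub in auto)
    \<comment> \<open>The argument of the first case with the families exchanged: this
      \<open>N\<close> is orthogonal to all \<open>u\<close>-differences.\<close>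
    have Nx: "lor N (lift (x u v)) \<noteq> 0" if uv: "u \<in> sq" "v \<in> sq" for u v
    proof
      assume "lor N (lift (x u v)) = 0"
      then obtain c where c: "c \<noteq> 0" "N = c *\<^sub>R lift (x u v)"
        using lor_null_proportional[OF Nn N0] by blast
      obtain u' where u': "u' \<in> sq" "x u' v \<noteq> x u v" using ncu[OF uv] by blast
      have "(F u' v - F 0 v) - (F u v - F 0 v) \<in> span {p, q}"
        by (intro span_diff U uv u')
      then have "lor (F u' v - F u v) N = 0" using zN by simp
      then show False using u' c pos[OF u'(1) uv(2)]
        by (simp add: F_def lor_simps lor_lift)
    qed
    have "\<forall>u\<in>sq. \<forall>v\<in>sq. lor N (lift (x u v)) \<noteq> 0" using Nx by blast
    from transport[OF Nn N0 this] obtain m y w' L h g' where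
      L: "mobius m" "linear L" "\<forall>a b. lor (L a) (L b) = lor a b" "h \<noteq> 0" "L N = (0, 0, h)"
      and *: "\<forall>u\<in>sq. \<forall>v\<in>sq. w' u v > 0 \<and> m (Some (x u v)) = Some (y u v) \<and>
         L (F u v) = w' u v *\<^sub>R lift (y u v)"
      and g': "g' C1_differentiable_on UNIV" "range g' = y 0 ` sq"
      by (elim exE conjE) (rule that)
    have iso: "lor (L a) (L b) = lor a b" for a b using L(3) by blast
    have y: "w' u v > 0" "m (Some (x u v)) = Some (y u v)" "L (F u v) = w' u v *\<^sub>R lift (y u v)"
      if "u \<in> sq" "v \<in> sq" for u v
      using * that by auto
    \<comment> \<open>The pairing with the point at infinity reads off the first coordinate, so
      spheres through \<open>N\<close> become planes.\<close>
    have fst0: "fst (L z) = 0" if "z \<in> span {p, q}" for z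
    proof -
      have "lor (L z) (0, 0, h) = 0" using zN[OF that] iso[of z N] by (simp add: L(5))
      then show ?thesis using L(4) by (simp add: lor_def)
    qed
    have "\<exists>S. surface_of_revolution S \<and> (\<forall>u\<in>sq. \<forall>v\<in>sq. y u v \<in> S)"
    proof (rule in_surface_of_revolution[where w = w' and y = y and g = g'])
      show "w' u v *\<^sub>R lift (y u v) - w' 0 v *\<^sub>R lift (y 0 v) \<in> span {L p, L r}"
        if "u \<in> sq" "v \<in> sq" for u v
        using Lspan[OF L(2), of "F u v - F 0 v" p r] U[OF that] sub that 0
        by (auto simp: y(3) linear_diff[OF L(2)])
    qed (use y(1) g' pp rr pr fst0 ps rs iso in auto)
    then obtain S where S: "surface_of_revolution S" "\<And>u v. u \<in> sq \<Longrightarrow> v \<in> sq \<Longrightarrow> y u v \<in> S"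
      by blast
    then show ?thesis using L(1) y(2) by (intro exI[of _ m] exI[of _ S]) auto
  qed
qed

section \<open>Tangents of circles\<close>

lemma has_vector_derivative_slope:
  assumes "(f has_vector_derivative f') (at t within S)"
  shows "((\<lambda>t'. (f t' - f t) /\<^sub>R (t' - t)) \<longlongrightarrow> f') (at t within S)"
proof -
  have *: "((\<lambda>y. norm (f y - f t - (y - t) *\<^sub>R f') / norm (y - t)) \<longlongrightarrow> 0) (at t within S)"
    using assms unfolding has_vector_derivative_def has_derivative_iff_norm by simp
  have "((\<lambda>y. norm ((f y - f t) /\<^sub>R (y - t) - f')) \<longlongrightarrow> 0) (at t within S)"
  proof (rule Lim_transform_eventually[OF *])
    have "norm (f y - f t - (y - t) *\<^sub>R f') / norm (y - t) = norm ((f y - f t) /\<^sub>R (y - t) - f')"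
      if "y \<noteq> t" for y
    proof -
      have "(f y - f t) /\<^sub>R (y - t) - f' = (f y - f t - (y - t) *\<^sub>R f') /\<^sub>R (y - t)"
        using that by (simp add: scaleR_diff_right)
      then show ?thesis by (simp add: divide_inverse mult.commute)
    qed
    then show "\<forall>\<^sub>F y in at t within S. norm (f y - f t - (y - t) *\<^sub>R f') / norm (y - t) =
        norm ((f y - f t) /\<^sub>R (y - t) - f')"
      unfolding eventually_at_filter by simp
  qed
  then show ?thesis by (simp add: tendsto_norm_zero_iff LIM_zero_iff)
qed

text \<open>Half angles make the chord of two points bilinear in their pairs \<open>(s, c)\<close>,
  as \<open>circle_chord\<close> shows.\<close>

lemma polar_half_angle:
  fixes a b r :: real
  assumes "a\<^sup>2 + b\<^sup>2 = r\<^sup>2"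
  obtains s c where "a = r * (c\<^sup>2 - s\<^sup>2)" "b = r * (2 * s * c)" "s\<^sup>2 + c\<^sup>2 = 1"
proof (cases "r = 0")
  case True
  then show thesis using that[of 0 1] assms by (simp add: sum_power2_eq_zero_iff)
next
  case False
  then have "(a / r)\<^sup>2 + (b / r)\<^sup>2 = 1"
    using assms by (simp add: power_divide add_divide_distrib[symmetric])
  then obtain t where t: "a / r = cos t" "b / r = sin t"
    using sincos_total_2pi by metis
  show thesis
  proof (rule that[of "cos (t / 2)" "sin (t / 2)"])
    show "a = r * ((cos (t / 2))\<^sup>2 - (sin (t / 2))\<^sup>2)"
      using t(1) False unfolding cos_double[symmetric] by (simp add: field_simps)
    show "b = r * (2 * sin (t / 2) * cos (t / 2))"
      using t(2) False unfolding sin_double[symmetric] by (simp add: field_simps)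
  qed (simp)
qed

lemma circle_chord:
  fixes s c s' c' r :: real
  assumes "s\<^sup>2 + c\<^sup>2 = 1" "s'\<^sup>2 + c'\<^sup>2 = 1"
  shows "(r * (c\<^sup>2 - s\<^sup>2) - r * (c'\<^sup>2 - s'\<^sup>2))\<^sup>2 + (r * (2 * s * c) - r * (2 * s' * c'))\<^sup>2 =
    (2 * r * (s * c' - c * s'))\<^sup>2"
proof -
  have "(r * (c\<^sup>2 - s\<^sup>2) - r * (c'\<^sup>2 - s'\<^sup>2))\<^sup>2 + (r * (2 * s * c) - r * (2 * s' * c'))\<^sup>2 =
     r\<^sup>2 * ((s\<^sup>2 + c\<^sup>2)\<^sup>2 + (s'\<^sup>2 + c'\<^sup>2)\<^sup>2 - 2 * (s\<^sup>2 + c\<^sup>2) * (s'\<^sup>2 + c'\<^sup>2) + 4 * (s * c' - c * s')\<^sup>2)"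
    by algebra
  then show ?thesis by (simp add: assms power_mult_distrib)
qed

lemma concyclic_chords:
  assumes "concyclic P"
  obtains r and s c :: "real^3 \<Rightarrow> real" where
    "\<And>p q. p \<in> P \<Longrightarrow> q \<in> P \<Longrightarrow> (norm (p - q))\<^sup>2 = (2 * r * (s p * c q - c p * s q))\<^sup>2"
proof -
  obtain z r n where r: "r > 0" and n: "n \<noteq> 0" and P: "\<And>p. p \<in> P \<Longrightarrow> dist p z = r \<and> n \<bullet> (p - z) = 0"
    using assms unfolding concyclic_def by blast
  \<comment> \<open>An orthogonal map takes the normal to the third axis, so that the first two
    coordinates describe the circle.\<close>
  have "norm n = norm (norm n *\<^sub>R axis (3::3) 1 :: real^3)" by simp
  then obtain f :: "real^3 \<Rightarrow> real^3" where f: "orthogonal_transformation f" "f n = norm n *\<^sub>R axis (3::3) 1"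
    by (rule orthogonal_transformation_exists)
  have inner: "f a \<bullet> f b = a \<bullet> b" for a b
    using f(1) by (simp add: orthogonal_transformation_def)
  have lin: "linear f" using f(1) by (simp add: orthogonal_transformation_def)
  have f3: "f (p - z) $ 3 = 0" if "p \<in> P" for p
  proof -
    have "norm n * (f (p - z) $ 3) = f n \<bullet> f (p - z)"
      by (simp add: f(2) inner_axis')
    also have "\<dots> = 0" using P[OF that] by (simp add: inner)
    finally show ?thesis using n by simp
  qed
  have sq3: "(norm a)\<^sup>2 = (f a $ 1)\<^sup>2 + (f a $ 2)\<^sup>2 + (f a $ 3)\<^sup>2" for a
    using inner[of a a] unfolding power2_norm_eq_inner
    by (simp add: inner_vec_def sum_3 power2_eq_square)
  have circ: "(f (p - z) $ 1)\<^sup>2 + (f (p - z) $ 2)\<^sup>2 = r\<^sup>2" if "p \<in> P" for p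
    using sq3[of "p - z"] P[OF that] f3[OF that] by (simp add: dist_norm)
  have "\<forall>p. \<exists>s c. p \<in> P \<longrightarrow> f (p - z) $ 1 = r * (c\<^sup>2 - s\<^sup>2) \<and> f (p - z) $ 2 = r * (2 * s * c) \<and> s\<^sup>2 + c\<^sup>2 = 1"
    using polar_half_angle[OF circ] by metis
  then obtain s c where sc: "\<And>p. p \<in> P \<Longrightarrow> f (p - z) $ 1 = r * ((c p)\<^sup>2 - (s p)\<^sup>2) \<and>
      f (p - z) $ 2 = r * (2 * s p * c p) \<and> (s p)\<^sup>2 + (c p)\<^sup>2 = 1"
    by metis
  show thesis
  proof (rule that[of r s c])
    fix p q assume pq: "p \<in> P" "q \<in> P"
    have fd: "f (p - q) = f (p - z) - f (q - z)"
      by (simp add: linear_diff[OF lin])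
    show "(norm (p - q))\<^sup>2 = (2 * r * (s p * c q - c p * s q))\<^sup>2"
      unfolding sq3[of "p - q"] fd
      using f3[OF pq(1)] f3[OF pq(2)] sc[OF pq(1)] sc[OF pq(2)] circle_chord[of "s p" "c p" "s q" "c q" r]
      by simp
  qed
qed

text \<open>In half angles the chords are the sines of differences, so Ptolemy's identity is the Pluecker
  relation \<open>B = A + C\<close> in the proof. Squaring it twice removes the dependence on the order of the points.\<close>

lemma concyclic_ptolemy:
  assumes "concyclic P" "a \<in> P" "b \<in> P" "c \<in> P" "d \<in> P"
  defines "\<alpha> \<equiv> (norm (a - b))\<^sup>2 * (norm (c - d))\<^sup>2"
    and "\<beta> \<equiv> (norm (a - c))\<^sup>2 * (norm (b - d))\<^sup>2"
    and "\<gamma> \<equiv> (norm (a - d))\<^sup>2 * (norm (b - c))\<^sup>2"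
  shows "(\<beta> - \<alpha>)\<^sup>2 - 2 * \<gamma> * (\<alpha> + \<beta>) + \<gamma>\<^sup>2 = 0"
proof -
  obtain r and s k :: "real^3 \<Rightarrow> real" where
    *: "\<And>p q. p \<in> P \<Longrightarrow> q \<in> P \<Longrightarrow> (norm (p - q))\<^sup>2 = (2 * r * (s p * k q - k p * s q))\<^sup>2"
    using concyclic_chords[OF assms(1)] by blast
  define A where "A = (2 * r * (s a * k b - k a * s b)) * (2 * r * (s c * k d - k c * s d))"
  define B where "B = (2 * r * (s a * k c - k a * s c)) * (2 * r * (s b * k d - k b * s d))"
  define C where "C = (2 * r * (s a * k d - k a * s d)) * (2 * r * (s b * k c - k b * s c))"
  have "\<alpha> = A\<^sup>2" "\<beta> = B\<^sup>2" "\<gamma> = C\<^sup>2"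
    unfolding \<alpha>_def \<beta>_def \<gamma>_def A_def B_def C_def
    by (simp_all only: *[OF assms(2,3)] *[OF assms(4,5)] *[OF assms(2,4)] *[OF assms(3,5)]
        *[OF assms(2,5)] *[OF assms(3,4)] power_mult_distrib)
  moreover have "B = A + C" unfolding A_def B_def C_def by algebra
  moreover have "((A + C)\<^sup>2 - A\<^sup>2)\<^sup>2 - 2 * C\<^sup>2 * (A\<^sup>2 + (A + C)\<^sup>2) + (C\<^sup>2)\<^sup>2 = 0"
    by algebra
  ultimately show ?thesis by simp
qed

text \<open>The limit of Ptolemy's identity as \<open>t'\<close> tends to \<open>t\<close>. For
  \<open>d \<noteq> 0\<close> it is equality in the Cauchy-Schwarz inequality for \<open>f'\<close>
  and the reflection of \<open>g'\<close> in the plane normal to \<open>d\<close>: these are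
  parallel when both vectors touch a common circle.\<close>

lemma concyclic_tangent_identity:
  fixes f g :: "real \<Rightarrow> real^3"
  assumes f: "(f has_vector_derivative f') (at t within sq)"
    and g: "(g has_vector_derivative g') (at t within sq)"
    and t: "t \<in> sq"
    and conc: "\<And>t'. t' \<in> sq \<Longrightarrow> t' \<noteq> t \<Longrightarrow> concyclic {f t, g t, f t', g t'}"
  defines "d \<equiv> f t - g t"
  shows "((d \<bullet> d) * (f' \<bullet> g') - 2 * (d \<bullet> f') * (d \<bullet> g'))\<^sup>2 = (d \<bullet> d)\<^sup>2 * (f' \<bullet> f') * (g' \<bullet> g')"
proof -
  define F where "F = at t within sq"
  define P where "P t' = (f t' - f t) /\<^sub>R (t' - t)" for t'
  define Q where "Q t' = (g t' - g t) /\<^sub>R (t' - t)" for t'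
  have Pl: "(P \<longlongrightarrow> f') F" and Ql: "(Q \<longlongrightarrow> g') F"
    using f g unfolding P_def[abs_def] Q_def[abs_def] F_def by (auto intro: has_vector_derivative_slope)
  have hl: "((\<lambda>t'. t' - t) \<longlongrightarrow> 0) F"
    unfolding F_def by (intro tendsto_eq_intros) auto
  have nontriv: "F \<noteq> bot"
    unfolding F_def sq_def using t
    by (simp add: trivial_limit_within sq_def islimpt_Icc)
  define A where "A = d \<bullet> d"
  define D where "D p q h = 2 * A * (p \<bullet> q) - 4 * (d \<bullet> p) * (d \<bullet> q)
      + h * (2 * (d \<bullet> p) * (q \<bullet> q) - 2 * (d \<bullet> q) * (p \<bullet> p)) + h\<^sup>2 * ((p \<bullet> p) * (q \<bullet> q))"
    for p q :: "real^3" and h :: real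
  define E where "E p q h = (D p q h)\<^sup>2 - 2 * (p \<bullet> p) * (q \<bullet> q) * (A * ((d + h *\<^sub>R (p - q)) \<bullet> (d + h *\<^sub>R (p - q)))
      + ((d + h *\<^sub>R p) \<bullet> (d + h *\<^sub>R p)) * ((d - h *\<^sub>R q) \<bullet> (d - h *\<^sub>R q))) + h\<^sup>2 * (h\<^sup>2 * ((p \<bullet> p) * (q \<bullet> q))\<^sup>2)"
    for p q :: "real^3" and h :: real
  \<comment> \<open>\<open>h\<^sup>4 E\<close> is Ptolemy's identity for the four points at \<open>t\<close> and \<open>t + h\<close>, with \<open>f\<close> and \<open>g\<close> moved by \<open>h p\<close> and \<open>h q\<close>.\<close>
  have "E (P t') (Q t') (t' - t) = 0" if t': "t' \<in> sq" "t' \<noteq> t" for t'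
  proof -
    define h p q where "h = t' - t" "p = P t'" "q = Q t'"
    have h: "h \<noteq> 0" using t' by (simp add: h_p_q_def)
    have ft: "f t' = f t + h *\<^sub>R p" and gt: "g t' = g t + h *\<^sub>R q"
      using t'(2) by (simp_all add: h_p_q_def P_def Q_def)
    let ?\<alpha> = "A * ((d + h *\<^sub>R (p - q)) \<bullet> (d + h *\<^sub>R (p - q)))"
    let ?\<beta> = "((d - h *\<^sub>R q) \<bullet> (d - h *\<^sub>R q)) * ((d + h *\<^sub>R p) \<bullet> (d + h *\<^sub>R p))"
    let ?\<gamma> = "(h\<^sup>2 * (p \<bullet> p)) * (h\<^sup>2 * (q \<bullet> q))"
    have n: "(norm (f t - g t))\<^sup>2 = A" "(norm (f t' - g t'))\<^sup>2 = (d + h *\<^sub>R (p - q)) \<bullet> (d + h *\<^sub>R (p - q))"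
      "(norm (f t - g t'))\<^sup>2 = (d - h *\<^sub>R q) \<bullet> (d - h *\<^sub>R q)"
      "(norm (g t - f t'))\<^sup>2 = (d + h *\<^sub>R p) \<bullet> (d + h *\<^sub>R p)"
      "(norm (f t - f t'))\<^sup>2 = h\<^sup>2 * (p \<bullet> p)" "(norm (g t - g t'))\<^sup>2 = h\<^sup>2 * (q \<bullet> q)"
    proof -
      have "f t' - g t' = d + h *\<^sub>R (p - q)" "f t - g t' = d - h *\<^sub>R q" "g t - f t' = - (d + h *\<^sub>R p)"
        "f t - f t' = - (h *\<^sub>R p)" "g t - g t' = - (h *\<^sub>R q)"
        by (simp_all add: ft gt d_def algebra_simps)
      then show "(norm (f t - g t))\<^sup>2 = A" "(norm (f t' - g t'))\<^sup>2 = (d + h *\<^sub>R (p - q)) \<bullet> (d + h *\<^sub>R (p - q))"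
        "(norm (f t - g t'))\<^sup>2 = (d - h *\<^sub>R q) \<bullet> (d - h *\<^sub>R q)"
        "(norm (g t - f t'))\<^sup>2 = (d + h *\<^sub>R p) \<bullet> (d + h *\<^sub>R p)"
        "(norm (f t - f t'))\<^sup>2 = h\<^sup>2 * (p \<bullet> p)" "(norm (g t - g t'))\<^sup>2 = h\<^sup>2 * (q \<bullet> q)"
        by (simp_all only: norm_minus_cancel power2_norm_eq_inner A_def d_def)
          (simp_all add: power2_eq_square)
    qed
    have "(?\<beta> - ?\<alpha>)\<^sup>2 - 2 * ?\<gamma> * (?\<alpha> + ?\<beta>) + ?\<gamma>\<^sup>2 = 0"
      using concyclic_ptolemy[OF conc[OF t'], of "f t" "g t" "g t'" "f t'"]
      unfolding norm_minus_commute[of "g t'" "f t'"] n by simp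
    \<comment> \<open>The two products agree to first order in \<open>h\<close>, which makes
      Ptolemy's identity divisible by \<open>h ^ 4\<close>.\<close>
    moreover have "?\<beta> - ?\<alpha> = h\<^sup>2 * D p q h"
      unfolding D_def A_def
      by (simp add: inner_add_left inner_add_right inner_diff_left inner_diff_right
          inner_commute[of p d] inner_commute[of q d] inner_commute[of q p])
        algebra
    ultimately have "h ^ 4 * E p q h = 0"
      unfolding E_def by algebra
    then show ?thesis using h by (simp add: h_p_q_def)
  qed
  then have "\<forall>\<^sub>F t' in F. E (P t') (Q t') (t' - t) = 0"
    unfolding F_def eventually_at_filter by auto
  then have "((\<lambda>t'. E (P t') (Q t') (t' - t)) \<longlongrightarrow> 0) F"
    by (rule tendsto_eventually)
  moreover have "((\<lambda>t'. E (P t') (Q t') (t' - t)) \<longlongrightarrow> E f' g' 0) F"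
    unfolding E_def D_def by (intro tendsto_intros Pl Ql hl)
  ultimately have "E f' g' 0 = 0"
    using tendsto_unique[OF nontriv] by blast
  then have "4 * ((A * (f' \<bullet> g') - 2 * (d \<bullet> f') * (d \<bullet> g'))\<^sup>2 - A\<^sup>2 * (f' \<bullet> f') * (g' \<bullet> g')) = 0"
    unfolding E_def D_def by (simp add: A_def[symmetric]) algebra
  then show ?thesis unfolding A_def by simp
qed

section \<open>Orthogonality and sphericity along a single parameter line\<close>

lemma convex_sq: "convex sq" and connected_sq: "connected sq"
  by (simp_all add: sq_def)

lemma islimpt_sq: "t \<in> sq \<Longrightarrow> t islimpt sq"
  by (simp add: sq_def islimpt_Icc)

lemma at_within_sq_nontrivial: "t \<in> sq \<Longrightarrow> at t within sq \<noteq> bot"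
  by (simp add: trivial_limit_within islimpt_sq)

lemma has_vector_derivative_unique_sq:
  assumes "(f has_vector_derivative a) (at t within sq)" "(f has_vector_derivative b) (at t within sq)" "t \<in> sq"
  shows "a = b"
  by (rule vector_derivative_unique_within[OF at_within_sq_nontrivial[OF assms(3)] assms(1,2)])

text \<open>Both ends of the secant may move, by the mean value inequality on a convex neighbourhood
  where \<open>\<gamma>'\<close> is close to \<open>\<gamma>' a\<close>.\<close>

lemma C1_strict_slope:
  fixes \<gamma> :: "real \<Rightarrow> 'a::real_normed_vector"
  assumes d: "\<And>u. u \<in> S \<Longrightarrow> (\<gamma> has_vector_derivative \<gamma>' u) (at u within S)"
    and c: "continuous_on S \<gamma>'" and S: "convex S" "a \<in> S"
  shows "((\<lambda>(u, u'). (\<gamma> u - \<gamma> u') /\<^sub>R (u - u')) \<longlongrightarrow> \<gamma>' a)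
    (at (a, a) within {(u, u'). u \<in> S \<and> u' \<in> S \<and> u \<noteq> u'})"
proof (rule tendstoI)
  fix e :: real assume "e > 0"
  then have e: "e / 2 > 0" by simp
  obtain \<delta> where \<delta>: "\<delta> > 0" "\<And>u. u \<in> S \<Longrightarrow> dist u a < \<delta> \<Longrightarrow> dist (\<gamma>' u) (\<gamma>' a) < e / 2"
    using c S(2) e unfolding continuous_on_iff by metis
  let ?T = "S \<inter> ball a \<delta>"
  have "dist ((\<gamma> u - \<gamma> u') /\<^sub>R (u - u')) (\<gamma>' a) < e"
    if u: "u \<in> S" "u' \<in> S" "u \<noteq> u'" and near: "dist (u, u') (a, a) < \<delta>" for u u'
  proof -
    have T: "u \<in> ?T" "u' \<in> ?T"
      using u near dist_fst_le[of "(u, u')" "(a, a)"] dist_snd_le[of "(u, u')" "(a, a)"]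
      by (auto simp: dist_commute)
    have le: "norm (\<gamma> u - \<gamma> u' - (u - u') *\<^sub>R \<gamma>' a) \<le> norm (u - u') * (e / 2)"
    proof (rule vector_differentiable_bound_linearization)
      show "(\<gamma> has_vector_derivative \<gamma>' z) (at z within ?T)" if "z \<in> ?T" for z
        using that by (intro has_vector_derivative_within_subset[OF d]) auto
      show "closed_segment u' u \<subseteq> ?T"
        using S(1) T by (intro closed_segment_subset convex_Int) auto
      show "norm (\<gamma>' z - \<gamma>' a) \<le> e / 2" if "z \<in> ?T" for z
      proof -
        have "dist (\<gamma>' z) (\<gamma>' a) < e / 2" using \<delta>(2)[of z] that by (simp add: dist_commute)
        then show ?thesis by (simp add: dist_norm)
      qed
      show "a \<in> ?T" using S(2) \<delta>(1) by simp
    qed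
    have eq: "(\<gamma> u - \<gamma> u') /\<^sub>R (u - u') - \<gamma>' a = (\<gamma> u - \<gamma> u' - (u - u') *\<^sub>R \<gamma>' a) /\<^sub>R (u - u')"
      using u(3) by (simp add: scaleR_diff_right)
    have "norm ((\<gamma> u - \<gamma> u') /\<^sub>R (u - u') - \<gamma>' a) =
        norm (\<gamma> u - \<gamma> u' - (u - u') *\<^sub>R \<gamma>' a) / norm (u - u')"
      unfolding eq by (simp add: divide_inverse mult.commute)
    also have "\<dots> \<le> e / 2"
      using le u(3) by (simp only: divide_le_eq mult.commute) simp
    finally have "norm ((\<gamma> u - \<gamma> u') /\<^sub>R (u - u') - \<gamma>' a) \<le> e / 2" .
    then show ?thesis using \<open>e > 0\<close> by (simp add: dist_norm)
  qed
  then show "\<forall>\<^sub>F z in at (a, a) within {(u, u'). u \<in> S \<and> u' \<in> S \<and> u \<noteq> u'}.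
      dist (case z of (u, u') \<Rightarrow> (\<gamma> u - \<gamma> u') /\<^sub>R (u - u')) (\<gamma>' a) < e"
    unfolding eventually_at using \<delta>(1) by (intro exI[of _ \<delta>]) auto
qed

text \<open>Divided by the fourth power of \<open>u' - u\<close>, the identity has a limit as
  \<open>u'\<close> tends to \<open>u\<close>. Besides the square of
  \<open>\<gamma>' \<bullet> p u\<close>, this limit contains only a factor that is nonzero by
  \<open>reg\<close>.\<close>

lemma circle_tangents_orthogonal:
  fixes \<gamma> p :: "real \<Rightarrow> real^3"
  assumes d: "(\<gamma> has_vector_derivative \<gamma>') (at u within sq)" and u: "u \<in> sq"
    and p: "continuous_on sq p" and reg: "cross3 \<gamma>' (p u) \<noteq> 0"
    and id: "\<And>u'. u' \<in> sq \<Longrightarrow> u' \<noteq> u \<Longrightarrow> (let d = \<gamma> u' - \<gamma> u in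
      ((d \<bullet> d) * (p u' \<bullet> p u) - 2 * (d \<bullet> p u') * (d \<bullet> p u))\<^sup>2 =
      (d \<bullet> d)\<^sup>2 * (p u' \<bullet> p u') * (p u \<bullet> p u))"
  shows "\<gamma>' \<bullet> p u = 0"
proof -
  define Q where "Q u' = (\<gamma> u' - \<gamma> u) /\<^sub>R (u' - u)" for u'
  have Ql: "(Q \<longlongrightarrow> \<gamma>') (at u within sq)"
    unfolding Q_def[abs_def] by (rule has_vector_derivative_slope[OF d])
  have pl: "(p \<longlongrightarrow> p u) (at u within sq)"
    using p u by (simp add: continuous_on_def)
  define E where "E q b = ((q \<bullet> q) * (b \<bullet> p u) - 2 * (q \<bullet> b) * (q \<bullet> p u))\<^sup>2 -
      (q \<bullet> q)\<^sup>2 * (b \<bullet> b) * (p u \<bullet> p u)" for q b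
  have "E (Q u') (p u') = 0" if "u' \<in> sq" "u' \<noteq> u" for u'
  proof -
    define h where "h = u' - u"
    have h: "h \<noteq> 0" "\<gamma> u' - \<gamma> u = h *\<^sub>R Q u'" using that by (auto simp: h_def Q_def)
    have "h ^ 4 * E (Q u') (p u') = 0"
      using id[OF that] unfolding h(2) Let_def E_def by (simp, algebra)
    then show ?thesis using h by simp
  qed
  then have "\<forall>\<^sub>F u' in at u within sq. E (Q u') (p u') = 0"
    unfolding eventually_at_filter by auto
  then have "((\<lambda>u'. E (Q u') (p u')) \<longlongrightarrow> 0) (at u within sq)"
    by (rule tendsto_eventually)
  moreover have "((\<lambda>u'. E (Q u') (p u')) \<longlongrightarrow> E \<gamma>' (p u)) (at u within sq)"
    unfolding E_def by (intro tendsto_intros Ql pl)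
  ultimately have "E \<gamma>' (p u) = 0"
    using tendsto_unique[OF at_within_sq_nontrivial[OF u]] by blast
  then have "(\<gamma>' \<bullet> p u)\<^sup>2 * ((\<gamma>' \<bullet> p u)\<^sup>2 - (\<gamma>' \<bullet> \<gamma>') * (p u \<bullet> p u)) = 0"
    unfolding E_def by algebra
  moreover have "(\<gamma>' \<bullet> p u)\<^sup>2 - (\<gamma>' \<bullet> \<gamma>') * (p u \<bullet> p u) = - (norm (cross3 \<gamma>' (p u)))\<^sup>2"
    using norm_cross_dot[of \<gamma>' "p u"] by (simp add: power_mult_distrib power2_norm_eq_inner)
  ultimately show ?thesis using reg by simp
qed

text \<open>This is the linear independence of three lifts: \<open>o\<close> is the last coordinate of the
  corresponding equations \<open>k\<close> between lifted vectors.\<close>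

lemma secant_ratio_unique:
  fixes g1 g2 g3 t1 t2 t3 :: "'a::real_inner"
  assumes "g1 \<noteq> g2" "g1 \<noteq> g3" "g2 \<noteq> g3"
    and k: "t1 - t2 = k3 *\<^sub>R (g1 - g2)" "t1 - t3 = k2 *\<^sub>R (g1 - g3)" "t2 - t3 = k1 *\<^sub>R (g2 - g3)"
    and o: "(g1 - g2) \<bullet> (t1 + t2) = 0" "(g1 - g3) \<bullet> (t1 + t3) = 0" "(g2 - g3) \<bullet> (t2 + t3) = 0"
  shows "k2 = k3"
proof -
  define a b where "a = g1 - g3" "b = g2 - g3"
  have ab: "a \<noteq> 0" "b \<noteq> 0" "a \<noteq> b" "g1 - g2 = a - b" using assms by (auto simp: a_b_def)
  have t: "t1 = t3 + k2 *\<^sub>R a" "t2 = t3 + k1 *\<^sub>R b" using k by (auto simp: a_b_def algebra_simps)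
  have "k2 *\<^sub>R a - k1 *\<^sub>R b = k3 *\<^sub>R (a - b)" using k(1) unfolding ab(4) t by simp
  then have lin: "(k2 - k3) *\<^sub>R a = (k1 - k3) *\<^sub>R b" by (simp add: algebra_simps)
  have "(k1 - k2) * (a \<bullet> b) = 0"
  proof -
    have o': "(a - b) \<bullet> (t3 + k2 *\<^sub>R a + (t3 + k1 *\<^sub>R b)) = 0"
      "a \<bullet> (t3 + k2 *\<^sub>R a + t3) = 0" "b \<bullet> (t3 + k1 *\<^sub>R b + t3) = 0"
      using o unfolding ab(4) a_b_def[symmetric] t by auto
    show ?thesis using o'
      by (simp add: inner_add_right inner_diff_left inner_commute[of b a] algebra_simps)
  qed
  then consider "k1 = k2" | "a \<bullet> b = 0" by auto
  then show ?thesis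
  proof cases
    case 1
    then have "(k2 - k3) *\<^sub>R (a - b) = 0" using lin by (simp add: scaleR_diff_right)
    then show ?thesis using ab by simp
  next
    case 2
    have "(k2 - k3) * (a \<bullet> a) = (k1 - k3) * (b \<bullet> a)"
      using arg_cong[OF lin, of "\<lambda>z. z \<bullet> a"] by simp
    then show ?thesis using 2 ab by (simp add: inner_commute)
  qed
qed

text \<open>Up to sign, the reflection in the plane normal to the secant maps one unit tangent to
  the other. Near the diagonal the sign is positive, so their difference is parallel to the secant
  and their sum orthogonal to it.\<close>

lemma circle_tangents_secants:
  fixes \<gamma> p :: "real \<Rightarrow> real^3"
  assumes d: "\<And>u. u \<in> sq \<Longrightarrow> (\<gamma> has_vector_derivative \<gamma>' u) (at u within sq)"
    and c: "continuous_on sq \<gamma>'" "continuous_on sq p"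
    and ne: "\<And>u. u \<in> sq \<Longrightarrow> \<gamma>' u \<noteq> 0" "\<And>u. u \<in> sq \<Longrightarrow> p u \<noteq> 0"
    and orth: "\<And>u. u \<in> sq \<Longrightarrow> \<gamma>' u \<bullet> p u = 0"
    and id: "\<And>u u'. u \<in> sq \<Longrightarrow> u' \<in> sq \<Longrightarrow> u \<noteq> u' \<Longrightarrow> (let d = \<gamma> u - \<gamma> u' in
      ((d \<bullet> d) * (p u \<bullet> p u') - 2 * (d \<bullet> p u) * (d \<bullet> p u'))\<^sup>2 =
      (d \<bullet> d)\<^sup>2 * (p u \<bullet> p u) * (p u' \<bullet> p u'))"
    and a: "a \<in> sq"
  obtains \<delta> where "\<delta> > 0"
    "\<And>u u'. u \<in> sq \<Longrightarrow> u' \<in> sq \<Longrightarrow> u \<noteq> u' \<Longrightarrow> \<bar>u - a\<bar> < \<delta> \<Longrightarrow> \<bar>u' - a\<bar> < \<delta> \<Longrightarrow>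
      \<gamma> u \<noteq> \<gamma> u' \<and> (\<gamma> u - \<gamma> u') \<bullet> (sgn (p u) + sgn (p u')) = 0 \<and>
      (\<exists>k. sgn (p u) - sgn (p u') = k *\<^sub>R (\<gamma> u - \<gamma> u'))"
proof -
  define F where "F = at (a, a) within {(u, u'). u \<in> sq \<and> u' \<in> sq \<and> u \<noteq> u'}"
  define Q where "Q = (\<lambda>(u, u'). (\<gamma> u - \<gamma> u') /\<^sub>R (u - u'))"
  define t where "t u = sgn (p u)" for u
  have Ql: "(Q \<longlongrightarrow> \<gamma>' a) F"
    unfolding Q_def F_def by (rule C1_strict_slope[OF d c(1) convex_sq a])
  have tc: "continuous_on sq t"
    unfolding t_def sgn_div_norm by (intro continuous_intros c) (use ne in auto)
  have tl: "((\<lambda>z. t (fst z)) \<longlongrightarrow> t a) F" "((\<lambda>z. t (snd z)) \<longlongrightarrow> t a) F"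
  proof -
    have "continuous_on {(u, u'). u \<in> sq \<and> u' \<in> sq} (\<lambda>z. t (fst z))"
      "continuous_on {(u, u'). u \<in> sq \<and> u' \<in> sq} (\<lambda>z. t (snd z))"
      by (auto intro!: continuous_on_compose2[OF tc] continuous_intros)
    then have "((\<lambda>z. t (fst z)) \<longlongrightarrow> t a) (at (a, a) within {(u, u'). u \<in> sq \<and> u' \<in> sq})"
      "((\<lambda>z. t (snd z)) \<longlongrightarrow> t a) (at (a, a) within {(u, u'). u \<in> sq \<and> u' \<in> sq})"
      using a by (auto simp: continuous_on_def)
    then show "((\<lambda>z. t (fst z)) \<longlongrightarrow> t a) F" "((\<lambda>z. t (snd z)) \<longlongrightarrow> t a) F"
      unfolding F_def by (auto elim!: tendsto_within_subset)
  qed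
  have tt: "t u \<bullet> t u = 1" if "u \<in> sq" for u
    using ne(2)[OF that] by (simp add: t_def dot_square_norm norm_sgn)
  have ta: "\<gamma>' a \<bullet> t a = 0" using orth[OF a] by (simp add: t_def sgn_div_norm)
  \<comment> \<open>The circle condition says \<open>E\<^sup>2 = 1\<close>; orthogonality makes \<open>E\<close> tend to 1 on the diagonal, which fixes the sign.\<close>
  define E where "E z = t (fst z) \<bullet> t (snd z) - 2 * (Q z \<bullet> t (fst z)) * (Q z \<bullet> t (snd z)) / (Q z \<bullet> Q z)" for z
  have "(E \<longlongrightarrow> t a \<bullet> t a - 2 * (\<gamma>' a \<bullet> t a) * (\<gamma>' a \<bullet> t a) / (\<gamma>' a \<bullet> \<gamma>' a)) F"
    unfolding E_def[abs_def] by (intro tendsto_intros Ql tl) (use ne(1)[OF a] in simp)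
  then have "(E \<longlongrightarrow> 1) F" by (simp add: ta tt[OF a])
  then have "\<forall>\<^sub>F z in F. E z > 0" by (rule order_tendstoD) simp
  moreover have "\<forall>\<^sub>F z in F. Q z \<noteq> 0"
    using Ql ne(1)[OF a] by (rule tendsto_imp_eventually_ne)
  ultimately have "\<forall>\<^sub>F z in F. E z > 0 \<and> Q z \<noteq> 0" by (rule eventually_conj)
  then obtain \<delta> where \<delta>: "\<delta> > 0" and
    near: "\<And>u u'. u \<in> sq \<Longrightarrow> u' \<in> sq \<Longrightarrow> u \<noteq> u' \<Longrightarrow> dist (u, u') (a, a) < \<delta> \<Longrightarrow>
      E (u, u') > 0 \<and> Q (u, u') \<noteq> 0"
    unfolding F_def eventually_at by auto
  show thesis
  proof (rule that[of "\<delta> / 2"])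
    fix u u' assume u: "u \<in> sq" "u' \<in> sq" "u \<noteq> u'" "\<bar>u - a\<bar> < \<delta> / 2" "\<bar>u' - a\<bar> < \<delta> / 2"
    have "dist (u, u') (a, a) \<le> \<bar>u - a\<bar> + \<bar>u' - a\<bar>"
      by (simp add: dist_prod_def dist_real_def sqrt_sum_squares_le_sum_abs)
    then have E: "E (u, u') > 0" "Q (u, u') \<noteq> 0" using near[OF u(1-3)] u(4,5) by auto
    define q where "q = Q (u, u')"
    define h where "h = u - u'"
    have h: "h \<noteq> 0" "\<gamma> u - \<gamma> u' = h *\<^sub>R q" using u(3) by (simp_all add: h_def q_def Q_def)
    have q0: "q \<noteq> 0" using E(2) by (simp add: q_def)
    have pt: "p u = norm (p u) *\<^sub>R t u" "p u' = norm (p u') *\<^sub>R t u'"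
      using ne(2)[OF u(1)] ne(2)[OF u(2)] by (simp_all add: t_def sgn_div_norm)
    have Eq: "E (u, u') * (q \<bullet> q) = (q \<bullet> q) * (t u \<bullet> t u') - 2 * (q \<bullet> t u) * (q \<bullet> t u')"
      using q0 by (simp add: E_def q_def[symmetric] field_simps)
    have "(h ^ 4 * (norm (p u) * norm (p u'))\<^sup>2) *
        (((q \<bullet> q) * (t u \<bullet> t u') - 2 * (q \<bullet> t u) * (q \<bullet> t u'))\<^sup>2 - (q \<bullet> q)\<^sup>2) = 0"
    proof -
      define m n where "m = norm (p u)" "n = norm (p u')"
      have "((h *\<^sub>R q \<bullet> h *\<^sub>R q) * (m *\<^sub>R t u \<bullet> n *\<^sub>R t u') - 2 * (h *\<^sub>R q \<bullet> m *\<^sub>R t u) * (h *\<^sub>R q \<bullet> n *\<^sub>R t u'))\<^sup>2 =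
      (h *\<^sub>R q \<bullet> h *\<^sub>R q)\<^sup>2 * (m *\<^sub>R t u \<bullet> m *\<^sub>R t u) * (n *\<^sub>R t u' \<bullet> n *\<^sub>R t u')"
        using id[OF u(1-3)] pt unfolding Let_def h(2) m_n_def by metis
      then show ?thesis
        unfolding m_n_def[symmetric] by (simp add: tt u(1,2)) algebra
    qed
    moreover have "h ^ 4 * (norm (p u) * norm (p u'))\<^sup>2 \<noteq> 0" using h(1) ne(2) u by simp
    ultimately have "(E (u, u') * (q \<bullet> q))\<^sup>2 = (q \<bullet> q)\<^sup>2" unfolding Eq by simp
    then have "(E (u, u'))\<^sup>2 = 1" using q0 by (simp add: power_mult_distrib)
    then have E1: "E (u, u') = 1" using E(1) by (simp add: power2_eq_1_iff)
    \<comment> \<open>With this \<open>k\<close> the vector \<open>t u' - k *\<^sub>R q\<close> is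
      the reflection of \<open>t u'\<close>. It is a unit vector whose product with the unit vector
      \<open>t u\<close> is \<open>E (u, u') = 1\<close>, hence equal to \<open>t u\<close>.\<close>
    define k where "k = 2 * (q \<bullet> t u') / (q \<bullet> q)"
    have "(q \<bullet> q) * ((t u - t u' + k *\<^sub>R q) \<bullet> (t u - t u' + k *\<^sub>R q)) = 0"
    proof -
      have kq: "k * (q \<bullet> q) = 2 * (q \<bullet> t u')" using q0 by (simp add: k_def)
      have "(t u - t u' + k *\<^sub>R q) \<bullet> (t u - t u' + k *\<^sub>R q) =
          2 - 2 * (t u \<bullet> t u') + 2 * k * (q \<bullet> t u) - 2 * k * (q \<bullet> t u') + k * (k * (q \<bullet> q))"
        by (simp add: inner_add_left inner_add_right inner_diff_left inner_diff_right
            inner_commute[of "t u'" "t u"] inner_commute[of "t u" q] inner_commute[of "t u'" q] tt u algebra_simps)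
      also have "\<dots> = 2 - 2 * (t u \<bullet> t u' - k * (q \<bullet> t u))" unfolding kq by (simp add: algebra_simps)
      also have "\<dots> = 2 - 2 * E (u, u')" by (simp add: E_def q_def[symmetric] k_def)
      finally show ?thesis by (simp add: E1)
    qed
    then have tk: "t u - t u' = - (k *\<^sub>R q)" using q0 by (simp add: eq_neg_iff_add_eq_0)
    show "\<gamma> u \<noteq> \<gamma> u' \<and> (\<gamma> u - \<gamma> u') \<bullet> (sgn (p u) + sgn (p u')) = 0 \<and>
      (\<exists>k. sgn (p u) - sgn (p u') = k *\<^sub>R (\<gamma> u - \<gamma> u'))"
    proof (intro conjI exI)
      show "\<gamma> u \<noteq> \<gamma> u'" using h q0 by auto
      have "q \<bullet> (t u - t u') = - 2 * (q \<bullet> t u')"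
        using q0 unfolding tk by (simp add: k_def)
      then have "q \<bullet> (t u + t u') = 0" by (simp add: inner_diff_right inner_add_right)
      then show "(\<gamma> u - \<gamma> u') \<bullet> (sgn (p u) + sgn (p u')) = 0"
        unfolding h(2) t_def by simp
      show "sgn (p u) - sgn (p u') = (- k / h) *\<^sub>R (\<gamma> u - \<gamma> u')"
        using tk h by (simp add: t_def)
    qed
  qed (use \<delta> in simp)
qed

text \<open>By \<open>secant_ratio_unique\<close> all secants from \<open>a\<close> to nearby points
  have the same ratio, so the unit tangent is locally an affine function of \<open>\<gamma>\<close>.
  Connectedness of \<open>sq\<close> makes the ratio global.\<close>

lemma circle_tangents_spherical:
  fixes \<gamma> p :: "real \<Rightarrow> real^3"
  assumes d: "\<And>u. u \<in> sq \<Longrightarrow> (\<gamma> has_vector_derivative \<gamma>' u) (at u within sq)"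
    and c: "continuous_on sq \<gamma>'" "continuous_on sq p"
    and ne: "\<And>u. u \<in> sq \<Longrightarrow> \<gamma>' u \<noteq> 0" "\<And>u. u \<in> sq \<Longrightarrow> p u \<noteq> 0"
    and orth: "\<And>u. u \<in> sq \<Longrightarrow> \<gamma>' u \<bullet> p u = 0"
    and id: "\<And>u u'. u \<in> sq \<Longrightarrow> u' \<in> sq \<Longrightarrow> u \<noteq> u' \<Longrightarrow> (let d = \<gamma> u - \<gamma> u' in
      ((d \<bullet> d) * (p u \<bullet> p u') - 2 * (d \<bullet> p u) * (d \<bullet> p u'))\<^sup>2 =
      (d \<bullet> d)\<^sup>2 * (p u \<bullet> p u) * (p u' \<bullet> p u'))"
  obtains k where
    "\<And>u. u \<in> sq \<Longrightarrow> ((\<lambda>u. sgn (p u)) has_vector_derivative k *\<^sub>R \<gamma>' u) (at u within sq)"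
proof -
  let ?D = "\<lambda>k u. ((\<lambda>u. sgn (p u)) has_vector_derivative k *\<^sub>R \<gamma>' u) (at u within sq)"
  have loc: "\<exists>k. \<exists>\<delta>>0. \<forall>u\<in>sq. \<bar>u - a\<bar> < \<delta> \<longrightarrow> ?D k u" if a: "a \<in> sq" for a
  proof -
    obtain \<delta> where \<delta>: "\<delta> > 0" and near:
      "\<And>u u'. u \<in> sq \<Longrightarrow> u' \<in> sq \<Longrightarrow> u \<noteq> u' \<Longrightarrow> \<bar>u - a\<bar> < \<delta> \<Longrightarrow> \<bar>u' - a\<bar> < \<delta> \<Longrightarrow>
        \<gamma> u \<noteq> \<gamma> u' \<and> (\<gamma> u - \<gamma> u') \<bullet> (sgn (p u) + sgn (p u')) = 0 \<and>
        (\<exists>k. sgn (p u) - sgn (p u') = k *\<^sub>R (\<gamma> u - \<gamma> u'))"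
      using circle_tangents_secants[OF assms a] by blast
    \<comment> \<open>The secant from \<open>a\<close> to this auxiliary \<open>b\<close> fixes
      \<open>k\<close>; any third parameter is compared with these two.\<close>
    obtain b where b: "b \<in> sq" "b \<noteq> a" "\<bar>b - a\<bar> < \<delta>"
      using islimpt_sq[OF a] \<delta> unfolding islimpt_approachable dist_real_def by blast
    have aa: "\<bar>a - a\<bar> < \<delta>" using \<delta> by simp
    obtain k where k: "sgn (p a) - sgn (p b) = k *\<^sub>R (\<gamma> a - \<gamma> b)"
      using near[OF a b(1) b(2)[symmetric] aa b(3)] by blast
    have eq: "sgn (p u) = sgn (p a) + k *\<^sub>R (\<gamma> u - \<gamma> a)" if u: "u \<in> sq" "\<bar>u - a\<bar> < \<delta>" for u
    proof -
      consider "u = a" | "u = b" | "u \<noteq> a" "u \<noteq> b" by blast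
      then show ?thesis
      proof cases
        case 2
        then show ?thesis using k by (simp add: algebra_simps)
      next
        case 3
        note ab = near[OF a b(1) b(2)[symmetric] aa b(3)]
          and au = near[OF a u(1) 3(1)[symmetric] aa u(2)]
          and bu = near[OF b(1) u(1) 3(2)[symmetric] b(3) u(2)]
        obtain k2 k1 where ks: "sgn (p a) - sgn (p u) = k2 *\<^sub>R (\<gamma> a - \<gamma> u)"
          "sgn (p b) - sgn (p u) = k1 *\<^sub>R (\<gamma> b - \<gamma> u)"
          using au bu by blast
        have "k2 = k"
          by (rule secant_ratio_unique[of "\<gamma> a" "\<gamma> b" "\<gamma> u"]) (use ab au bu k ks in auto)
        then show ?thesis using ks(1) by (simp add: algebra_simps)
      qed simp
    qed
    have "?D k u" if u: "u \<in> sq" "\<bar>u - a\<bar> < \<delta>" for u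
    proof (rule has_vector_derivative_transform_within)
      show "((\<lambda>u. sgn (p a) + k *\<^sub>R (\<gamma> u - \<gamma> a)) has_vector_derivative k *\<^sub>R \<gamma>' u) (at u within sq)"
        by (auto intro!: derivative_eq_intros d u)
      show "\<delta> - \<bar>u - a\<bar> > 0" using u by simp
      show "sgn (p a) + k *\<^sub>R (\<gamma> u' - \<gamma> a) = sgn (p u')"
        if "u' \<in> sq" "dist u' u < \<delta> - \<bar>u - a\<bar>" for u'
        using that by (intro eq[symmetric]) (auto simp: dist_real_def)
    qed (use u in simp)
    then show ?thesis using \<delta> by blast
  qed
  \<comment> \<open>The ratio is determined by the derivative at \<open>u\<close> because
    \<open>\<gamma>' u\<close> does not vanish; hence the local values of \<open>k\<close> fit
    together.\<close>
  define K where "K u = (THE k. ?D k u)" for u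
  have K: "K u = k" if "u \<in> sq" "?D k u" for k u
    unfolding K_def
  proof (rule the_equality)
    fix k' assume "?D k' u"
    then have "k' *\<^sub>R \<gamma>' u = k *\<^sub>R \<gamma>' u"
      using that by (intro has_vector_derivative_unique_sq[where t = u]) auto
    then show "k' = k" using ne(1)[OF that(1)] by simp
  qed (fact that(2))
  have "K constant_on sq"
  proof (rule locally_constant_imp_constant[OF connected_sq])
    fix a assume a: "a \<in> sq"
    obtain k \<delta> where k: "\<delta> > 0" "\<And>u. u \<in> sq \<Longrightarrow> \<bar>u - a\<bar> < \<delta> \<Longrightarrow> ?D k u"
      using loc[OF a] by blast
    show "\<exists>T. openin (top_of_set sq) T \<and> a \<in> T \<and> (\<forall>u\<in>T. K u = K a)"
    proof (intro exI conjI ballI)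
      show "openin (top_of_set sq) (sq \<inter> ball a \<delta>)" by (simp add: openin_open_Int)
      show "a \<in> sq \<inter> ball a \<delta>" using a k by simp
      fix u assume "u \<in> sq \<inter> ball a \<delta>"
      then have u: "u \<in> sq" "\<bar>u - a\<bar> < \<delta>" by (auto simp: dist_real_def)
      show "K u = K a" using K[OF u(1) k(2)[OF u]] K[OF a k(2)[OF a]] k(1) by simp
    qed
  qed
  then obtain k where k: "\<And>u. u \<in> sq \<Longrightarrow> K u = k" unfolding constant_on_def by blast
  have "?D k u" if u: "u \<in> sq" for u
  proof -
    obtain k' \<delta> where "\<delta> > 0" "\<forall>u'\<in>sq. \<bar>u' - u\<bar> < \<delta> \<longrightarrow> ?D k' u'"
      using loc[OF u] by blast
    then have k': "\<delta> > 0" "?D k' u" using u by auto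
    then have "k' = k" using K[OF u k'(2)] k[OF u] by simp
    then show ?thesis using k' by simp
  qed
  then show thesis by (rule that)
qed

section \<open>Circular nets\<close>

text \<open>The difference is the integral of \<open>g u\<close> over the \<open>v\<close>-interval,
  differentiated under the integral sign.\<close>

lemma mixed_difference:
  fixes f :: "real \<Rightarrow> real \<Rightarrow> 'a::euclidean_space"
  assumes fv: "\<And>u v. u \<in> sq \<Longrightarrow> v \<in> sq \<Longrightarrow> ((\<lambda>v. f u v) has_vector_derivative g u v) (at v within sq)"
    and gu: "\<And>u v. u \<in> sq \<Longrightarrow> v \<in> sq \<Longrightarrow> ((\<lambda>u. g u v) has_vector_derivative h u v) (at u within sq)"
    and h: "continuous_on (sq \<times> sq) (\<lambda>(u, v). h u v)"
    and u: "u \<in> sq" and v: "v0 \<in> sq" "v1 \<in> sq" "v0 \<le> v1"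
  shows "((\<lambda>u. f u v1 - f u v0) has_vector_derivative integral {v0..v1} (h u)) (at u within sq)"
proof -
  have sub: "{v0..v1} \<subseteq> sq" using v by (auto simp: sq_def)
  have int: "(g u has_integral (f u v1 - f u v0)) {v0..v1}" if "u \<in> sq" for u
    using that sub v(3)
    by (intro fundamental_theorem_of_calculus)
       (auto intro!: has_vector_derivative_within_subset[OF fv])
  have "((\<lambda>u. integral (cbox v0 v1) (g u)) has_vector_derivative integral (cbox v0 v1) (h u)) (at u within sq)"
  proof (rule leibniz_rule_vector_derivative)
    show "((\<lambda>u. g u v) has_vector_derivative h u v) (at u within sq)"
      if "u \<in> sq" "v \<in> cbox v0 v1" for u v
      using that sub by (intro gu) auto
    show "g u integrable_on cbox v0 v1" if "u \<in> sq" for u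
      using int[OF that] by auto
    show "continuous_on (sq \<times> cbox v0 v1) (\<lambda>(u, v). h u v)"
      by (rule continuous_on_subset[OF h]) (use sub in auto)
  qed (use u convex_sq in auto)
  then have I: "((\<lambda>u. integral {v0..v1} (g u)) has_vector_derivative integral {v0..v1} (h u)) (at u within sq)"
    by simp
  show ?thesis
    by (rule has_vector_derivative_transform[OF u _ I]) (simp add: integral_unique[OF int])
qed

text \<open>Schwarz's theorem on the closed square: two expressions for the
  \<open>u\<close>-derivative of \<open>f u v - f u 0\<close> are compared.\<close>

lemma mixed_partials_eq:
  fixes f :: "real \<Rightarrow> real \<Rightarrow> 'a::euclidean_space"
  assumes fu: "\<And>u v. u \<in> sq \<Longrightarrow> v \<in> sq \<Longrightarrow> ((\<lambda>u. f u v) has_vector_derivative g' u v) (at u within sq)"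
    and fv: "\<And>u v. u \<in> sq \<Longrightarrow> v \<in> sq \<Longrightarrow> ((\<lambda>v. f u v) has_vector_derivative g u v) (at v within sq)"
    and gu: "\<And>u v. u \<in> sq \<Longrightarrow> v \<in> sq \<Longrightarrow> ((\<lambda>u. g u v) has_vector_derivative h u v) (at u within sq)"
    and h: "continuous_on (sq \<times> sq) (\<lambda>(u, v). h u v)"
    and uv: "u \<in> sq" "v \<in> sq"
  shows "((\<lambda>v. g' u v) has_vector_derivative h u v) (at v within sq)"
proof -
  have 0: "0 \<in> sq" by (simp add: sq_def)
  have eq: "g' u v = g' u 0 + integral {0..v} (h u)" if v: "v \<in> sq" for v
  proof -
    have "((\<lambda>u. f u v - f u 0) has_vector_derivative g' u v - g' u 0) (at u within sq)"
      by (intro derivative_intros fu uv v 0)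
    moreover have "((\<lambda>u. f u v - f u 0) has_vector_derivative integral {0..v} (h u)) (at u within sq)"
      by (rule mixed_difference[OF fv gu h uv(1) 0 v]) (use v in \<open>auto simp: sq_def\<close>)
    ultimately have "g' u v - g' u 0 = integral {0..v} (h u)"
      by (rule has_vector_derivative_unique_sq) (rule uv)
    then show ?thesis by (simp add: algebra_simps)
  qed
  have "continuous_on sq (h u)"
    using continuous_on_compose2[OF h, of sq "\<lambda>v. (u, v)"] uv
    by (simp add: continuous_on_Pair image_subset_iff)
  then have "((\<lambda>v. integral {0..v} (h u)) has_vector_derivative h u v) (at v within sq)"
    using uv(2) unfolding sq_def by (intro integral_has_vector_derivative)
  then have I: "((\<lambda>v. g' u 0 + integral {0..v} (h u)) has_vector_derivative h u v) (at v within sq)"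
    by (auto intro!: derivative_eq_intros)
  show ?thesis
    by (rule has_vector_derivative_transform[OF uv(2) _ I]) (simp add: eq)
qed

lemma has_vector_derivative_norm:
  fixes f :: "real \<Rightarrow> 'a::real_inner"
  assumes "(f has_vector_derivative f') (at t within S)" "f t \<noteq> 0"
  shows "((\<lambda>t. norm (f t)) has_vector_derivative f' \<bullet> sgn (f t)) (at t within S)"
  using has_derivative_compose[OF assms(1)[unfolded has_vector_derivative_def] has_derivative_norm[OF assms(2)]]
  by (simp add: has_vector_derivative_def)

lemma constant_of_zero_derivative_sq:
  assumes "\<And>t. t \<in> sq \<Longrightarrow> (f has_vector_derivative 0) (at t within sq)" "a \<in> sq" "b \<in> sq"
  shows "f a = f b"
  using has_vector_derivative_zero_constant[OF convex_sq assms(1)] assms(2,3) by metis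

lemma cross3_eq_0_imp_parallel:
  assumes "cross3 s w = 0" "norm s = 1"
  shows "w = (s \<bullet> w) *\<^sub>R s"
proof -
  have "cross3 s (cross3 s w) = (s \<bullet> w) *\<^sub>R s - (s \<bullet> s) *\<^sub>R w" by (rule Lagrange)
  then show ?thesis using assms by (simp add: dot_square_norm)
qed

text \<open>Kept symmetric in the two parameters, with one common mixed derivative
  \<open>xw\<close>, so that \<open>swap\<close> yields each result for the other family.\<close>

locale circular_net =
  fixes x xu xv xw :: patch
  assumes xu: "\<And>u v. u \<in> sq \<Longrightarrow> v \<in> sq \<Longrightarrow> ((\<lambda>u. x u v) has_vector_derivative xu u v) (at u within sq)"
    and xv: "\<And>u v. u \<in> sq \<Longrightarrow> v \<in> sq \<Longrightarrow> ((\<lambda>v. x u v) has_vector_derivative xv u v) (at v within sq)"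
    and xuv: "\<And>u v. u \<in> sq \<Longrightarrow> v \<in> sq \<Longrightarrow> ((\<lambda>v. xu u v) has_vector_derivative xw u v) (at v within sq)"
    and xvu: "\<And>u v. u \<in> sq \<Longrightarrow> v \<in> sq \<Longrightarrow> ((\<lambda>u. xv u v) has_vector_derivative xw u v) (at u within sq)"
    and cont_xu: "continuous_on (sq \<times> sq) (\<lambda>(u, v). xu u v)"
    and cont_xv: "continuous_on (sq \<times> sq) (\<lambda>(u, v). xv u v)"
    and cont_xw: "continuous_on (sq \<times> sq) (\<lambda>(u, v). xw u v)"
    and reg: "\<And>u v. u \<in> sq \<Longrightarrow> v \<in> sq \<Longrightarrow> cross3 (xu u v) (xv u v) \<noteq> 0"
    and conc: "\<And>u0 u1 v0 v1. u0 \<in> sq \<Longrightarrow> u1 \<in> sq \<Longrightarrow> v0 \<in> sq \<Longrightarrow> v1 \<in> sq \<Longrightarrow>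
        u0 \<noteq> u1 \<Longrightarrow> v0 \<noteq> v1 \<Longrightarrow> concyclic {x u0 v0, x u1 v0, x u0 v1, x u1 v1}"
begin

lemma swap: "circular_net (\<lambda>u v. x v u) (\<lambda>u v. xv v u) (\<lambda>u v. xu v u) (\<lambda>u v. xw v u)"
proof
  have sw: "continuous_on (sq \<times> sq) (\<lambda>(u, v). f v u)" if "continuous_on (sq \<times> sq) (\<lambda>(u, v). f u v)"
    for f :: patch
    using continuous_on_compose2[OF that, of "sq \<times> sq" prod.swap]
    by (simp add: continuous_on_swap product_swap case_prod_unfold)
  show "continuous_on (sq \<times> sq) (\<lambda>(u, v). xu v u)" "continuous_on (sq \<times> sq) (\<lambda>(u, v). xv v u)"
    "continuous_on (sq \<times> sq) (\<lambda>(u, v). xw v u)"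
    by (fact sw[OF cont_xu] sw[OF cont_xv] sw[OF cont_xw])+
  show "cross3 (xv v u) (xu v u) \<noteq> 0" if "u \<in> sq" "v \<in> sq" for u v
    using reg[OF that(2,1)] by (simp add: cross_skew[of "xv v u"])
  show "concyclic {x v0 u0, x v0 u1, x v1 u0, x v1 u1}"
    if "u0 \<in> sq" "u1 \<in> sq" "v0 \<in> sq" "v1 \<in> sq" "u0 \<noteq> u1" "v0 \<noteq> v1" for u0 u1 v0 v1
    using conc[OF that(3,4,1,2,6,5)] by (simp add: insert_commute)
qed (rule xu xv xuv xvu; assumption)+

lemma xu_nonzero: "u \<in> sq \<Longrightarrow> v \<in> sq \<Longrightarrow> xu u v \<noteq> 0"
  and xv_nonzero: "u \<in> sq \<Longrightarrow> v \<in> sq \<Longrightarrow> xv u v \<noteq> 0"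
  using reg by force+

lemma continuous_on_line_u:
  fixes f :: patch
  assumes "continuous_on (sq \<times> sq) (\<lambda>(u, v). f u v)" "v \<in> sq"
  shows "continuous_on sq (\<lambda>u. f u v)"
  using continuous_on_compose2[OF assms(1), of sq "\<lambda>u. (u, v)"] assms(2)
  by (simp add: continuous_on_Pair image_subset_iff)

lemma tangent_identity:
  assumes "u \<in> sq" "u' \<in> sq" "v \<in> sq" "u \<noteq> u'"
  shows "let d = x u v - x u' v in
    ((d \<bullet> d) * (xv u v \<bullet> xv u' v) - 2 * (d \<bullet> xv u v) * (d \<bullet> xv u' v))\<^sup>2 =
    (d \<bullet> d)\<^sup>2 * (xv u v \<bullet> xv u v) * (xv u' v \<bullet> xv u' v)"
  unfolding Let_def
  by (rule concyclic_tangent_identity[OF xv xv]) (use assms conc in auto)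

lemma orthogonal:
  assumes u: "u \<in> sq" and v: "v \<in> sq"
  shows "xu u v \<bullet> xv u v = 0"
  by (rule circle_tangents_orthogonal[OF xu[OF u v] u continuous_on_line_u[OF cont_xv v] reg[OF u v]])
     (rule tangent_identity[OF _ u v])

lemma locally_injective:
  assumes a: "a \<in> sq" and v: "v \<in> sq"
  obtains \<delta> where "\<delta> > 0" "\<And>u u'. u \<in> sq \<Longrightarrow> u' \<in> sq \<Longrightarrow> u \<noteq> u' \<Longrightarrow>
    \<bar>u - a\<bar> < \<delta> \<Longrightarrow> \<bar>u' - a\<bar> < \<delta> \<Longrightarrow> x u v \<noteq> x u' v"
proof (rule circle_tangents_secants[OF xu[OF _ v] continuous_on_line_u[OF cont_xu v]
      continuous_on_line_u[OF cont_xv v] xu_nonzero[OF _ v] xv_nonzero[OF _ v] orthogonal[OF _ v]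
      tangent_identity[OF _ _ v] a])
  fix \<delta> :: real
  assume \<delta>: "\<delta> > 0" and near: "\<And>u u'. u \<in> sq \<Longrightarrow> u' \<in> sq \<Longrightarrow> u \<noteq> u' \<Longrightarrow>
    \<bar>u - a\<bar> < \<delta> \<Longrightarrow> \<bar>u' - a\<bar> < \<delta> \<Longrightarrow>
    x u v \<noteq> x u' v \<and> (x u v - x u' v) \<bullet> (sgn (xv u v) + sgn (xv u' v)) = 0 \<and>
      (\<exists>k. sgn (xv u v) - sgn (xv u' v) = k *\<^sub>R (x u v - x u' v))"
  show thesis by (rule that[OF \<delta>]) (simp add: near)
qed

text \<open>The number \<open>k v\<close> is the signed curvature of the sphere that contains the
  \<open>u\<close>-line at \<open>v\<close> and is orthogonal to the \<open>v\<close>-lines; the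
  value 0 means a plane.\<close>

lemma spherical_lines:
  obtains k where "\<And>u v. u \<in> sq \<Longrightarrow> v \<in> sq \<Longrightarrow>
    ((\<lambda>u. sgn (xv u v)) has_vector_derivative k v *\<^sub>R xu u v) (at u within sq)"
proof -
  have "\<forall>v\<in>sq. \<exists>k. \<forall>u\<in>sq. ((\<lambda>u. sgn (xv u v)) has_vector_derivative k *\<^sub>R xu u v) (at u within sq)"
  proof
    fix v assume v: "v \<in> sq"
    show "\<exists>k. \<forall>u\<in>sq. ((\<lambda>u. sgn (xv u v)) has_vector_derivative k *\<^sub>R xu u v) (at u within sq)"
      by (rule circle_tangents_spherical[OF xu[OF _ v] continuous_on_line_u[OF cont_xu v]
        continuous_on_line_u[OF cont_xv v] xu_nonzero[OF _ v] xv_nonzero[OF _ v] orthogonal[OF _ v]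
        tangent_identity[OF _ _ v]]) blast+
  qed
  then obtain k where "\<forall>v\<in>sq. \<forall>u\<in>sq.
      ((\<lambda>u. sgn (xv u v)) has_vector_derivative k v *\<^sub>R xu u v) (at u within sq)"
    by (rule bchoice[THEN exE])
  then show thesis by (intro that) blast
qed

text \<open>Together with \<open>- k v\<close> these are the coordinates of the Lorentz vector of
  that sphere. They are constant because \<open>sgn (xv u v)\<close> has derivative
  \<open>k v *\<^sub>R xu u v\<close> and is orthogonal to \<open>xu u v\<close>.\<close>

lemma sphere_invariants:
  assumes K: "\<And>u v. u \<in> sq \<Longrightarrow> v \<in> sq \<Longrightarrow>
      ((\<lambda>u. sgn (xv u v)) has_vector_derivative k v *\<^sub>R xu u v) (at u within sq)"
    and u: "u \<in> sq" "u' \<in> sq" and v: "v \<in> sq"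
  shows "sgn (xv u v) - k v *\<^sub>R x u v = sgn (xv u' v) - k v *\<^sub>R x u' v"
    and "2 * (x u v \<bullet> sgn (xv u v)) - k v * (x u v \<bullet> x u v) =
      2 * (x u' v \<bullet> sgn (xv u' v)) - k v * (x u' v \<bullet> x u' v)"
proof -
  show "sgn (xv u v) - k v *\<^sub>R x u v = sgn (xv u' v) - k v *\<^sub>R x u' v"
  proof (rule constant_of_zero_derivative_sq[OF _ u])
    fix t assume t: "t \<in> sq"
    show "((\<lambda>u. sgn (xv u v) - k v *\<^sub>R x u v) has_vector_derivative 0) (at t within sq)"
      using has_vector_derivative_diff[OF K[OF t v]
          bounded_linear.has_vector_derivative[OF bounded_linear_scaleR_right xu[OF t v], of "k v"]]
      by simp
  qed
  show "2 * (x u v \<bullet> sgn (xv u v)) - k v * (x u v \<bullet> x u v) =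
      2 * (x u' v \<bullet> sgn (xv u' v)) - k v * (x u' v \<bullet> x u' v)"
  proof (rule constant_of_zero_derivative_sq[OF _ u])
    fix t assume t: "t \<in> sq"
    have o: "xu t v \<bullet> sgn (xv t v) = 0" using orthogonal[OF t v] by (simp add: sgn_div_norm)
    show "((\<lambda>u. 2 * (x u v \<bullet> sgn (xv u v)) - k v * (x u v \<bullet> x u v)) has_vector_derivative 0) (at t within sq)"
      using K[OF t v] xu[OF t v] unfolding has_vector_derivative_def
      by (auto intro!: derivative_eq_intros simp: o fun_eq_iff inner_commute algebra_simps)
  qed
qed

text \<open>Differentiating \<open>xv\<close> as norm times direction writes \<open>xw\<close> as a
  multiple of \<open>xu\<close> plus a multiple of \<open>xv\<close>; the latter is orthogonal to
  \<open>xu\<close>.\<close>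

lemma norm_derivative:
  assumes K: "\<And>u v. u \<in> sq \<Longrightarrow> v \<in> sq \<Longrightarrow>
      ((\<lambda>u. sgn (xv u v)) has_vector_derivative k v *\<^sub>R xu u v) (at u within sq)"
    and u: "u \<in> sq" and v: "v \<in> sq"
  shows "xw u v \<bullet> xu u v = k v * norm (xv u v) * (norm (xu u v))\<^sup>2"
    and "((\<lambda>v. norm (xu u v)) has_vector_derivative k v * norm (xv u v) * norm (xu u v)) (at v within sq)"
proof -
  define r where "r = xw u v \<bullet> sgn (xv u v)"
  have nv: "((\<lambda>u. norm (xv u v)) has_vector_derivative r) (at u within sq)"
    unfolding r_def by (rule has_vector_derivative_norm[OF xvu[OF u v] xv_nonzero[OF u v]])
  have "((\<lambda>u. norm (xv u v) *\<^sub>R sgn (xv u v)) has_vector_derivative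
      norm (xv u v) *\<^sub>R (k v *\<^sub>R xu u v) + r *\<^sub>R sgn (xv u v)) (at u within sq)"
    by (rule has_vector_derivative_scaleR[OF nv[folded has_real_derivative_iff_has_vector_derivative] K[OF u v]])
  moreover have "norm a *\<^sub>R sgn a = a" for a :: "real^3"
    by (cases "a = 0") (simp_all add: sgn_div_norm)
  ultimately have "((\<lambda>u. xv u v) has_vector_derivative
      norm (xv u v) *\<^sub>R (k v *\<^sub>R xu u v) + r *\<^sub>R sgn (xv u v)) (at u within sq)"
    by simp
  then have xw: "xw u v = norm (xv u v) *\<^sub>R (k v *\<^sub>R xu u v) + r *\<^sub>R sgn (xv u v)"
    using has_vector_derivative_unique_sq[OF xvu[OF u v]] u by blast
  have "sgn (xv u v) \<bullet> xu u v = 0"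
    using orthogonal[OF u v] by (simp add: sgn_div_norm inner_commute)
  then show *: "xw u v \<bullet> xu u v = k v * norm (xv u v) * (norm (xu u v))\<^sup>2"
    unfolding xw by (simp add: inner_add_left power2_norm_eq_inner)
  have "xw u v \<bullet> sgn (xu u v) = k v * norm (xv u v) * norm (xu u v)"
    using * xu_nonzero[OF u v] by (simp add: sgn_div_norm power2_eq_square)
  then show "((\<lambda>v. norm (xu u v)) has_vector_derivative k v * norm (xv u v) * norm (xu u v)) (at v within sq)"
    using has_vector_derivative_norm[OF xuv[OF u v] xu_nonzero[OF u v]] by simp
qed

text \<open>Covers two lines that coincide pointwise, where their difference vector is 0 and defines
  no reflection. The inversion in the sphere of the line fixes it.\<close>

lemma gen_inversion_fixing_line:
  assumes v: "v \<in> sq"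
  obtains f where "gen_inversion f" "\<And>u. u \<in> sq \<Longrightarrow> f (Some (x u v)) = Some (x u v)"
proof -
  obtain k where K: "\<And>u v. u \<in> sq \<Longrightarrow> v \<in> sq \<Longrightarrow>
      ((\<lambda>u. sgn (xv u v)) has_vector_derivative k v *\<^sub>R xu u v) (at u within sq)"
    using spherical_lines by blast
  have 0: "0 \<in> sq" by (simp add: sq_def)
  have n: "norm (sgn (xv u v)) = 1" if "u \<in> sq" for u
    using xv_nonzero[OF that v] by (simp add: norm_sgn)
  define t where "t = sgn (xv 0 v)"
  have I: "sgn (xv u v) - k v *\<^sub>R x u v = t - k v *\<^sub>R x 0 v"
    "2 * (x u v \<bullet> sgn (xv u v)) - k v * (x u v \<bullet> x u v) = 2 * (x 0 v \<bullet> t) - k v * (x 0 v \<bullet> x 0 v)"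
    if "u \<in> sq" for u
    unfolding t_def by (rule sphere_invariants[OF K that 0 v]; assumption)+
  show thesis
  proof (cases "k v = 0")
    case True
    have t: "sgn (xv u v) = t" if "u \<in> sq" for u
      using I(1)[OF that] True by simp
    have b: "t \<bullet> x u v = t \<bullet> x 0 v" if "u \<in> sq" for u
      using I(2)[OF that] True by (simp add: t[OF that] inner_commute)
    show thesis
    proof (rule that[of "plane_reflection t (t \<bullet> x 0 v)"])
      have "t \<noteq> 0" using n[OF 0] by (auto simp: t_def)
      then show "gen_inversion (plane_reflection t (t \<bullet> x 0 v))"
        by (auto simp: gen_inversion_def)
    qed (simp add: plane_reflection_def b)
  next
    case False
    define c where "c = x 0 v - t /\<^sub>R k v"
    have c: "x u v - c = sgn (xv u v) /\<^sub>R k v" if "u \<in> sq" for u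
    proof -
      have "k v *\<^sub>R (x u v - c) = sgn (xv u v)"
        using I(1)[OF that] False by (simp add: c_def algebra_simps)
      then show ?thesis using False by (metis divideR_right)
    qed
    have nc: "(norm (x u v - c))\<^sup>2 = (1 / \<bar>k v\<bar>)\<^sup>2" if "u \<in> sq" for u
      unfolding c[OF that] using n[OF that] by (simp add: divide_inverse)
    show thesis
    proof (rule that[of "sphere_inversion c (1 / \<bar>k v\<bar>)"])
      show "gen_inversion (sphere_inversion c (1 / \<bar>k v\<bar>))"
        using False unfolding gen_inversion_def by (metis zero_less_abs_iff zero_less_divide_1_iff)
      show "sphere_inversion c (1 / \<bar>k v\<bar>) (Some (x u v)) = Some (x u v)" if u: "u \<in> sq" for u
      proof -
        have "x u v \<noteq> c" using nc[OF u] False by auto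
        then show ?thesis using nc[OF u] False by (simp add: sphere_inversion_def)
      qed
    qed
  qed
qed

text \<open>The logarithms of \<open>\<rho>\<close> and \<open>\<sigma>\<close> have the same mixed
  derivative, so their quotient is a function of \<open>u\<close> times a function of
  \<open>v\<close>. This permits a weight \<open>w\<close> for which the \<open>v\<close>-derivative
  of the rescaled lift does not depend on \<open>u\<close>.\<close>

lemma separable:
  obtains w where "separable_lift x w"
proof -
  interpret S: circular_net "\<lambda>u v. x v u" "\<lambda>u v. xv v u" "\<lambda>u v. xu v u" "\<lambda>u v. xw v u"
    by (rule swap)
  obtain k where K: "\<And>u v. u \<in> sq \<Longrightarrow> v \<in> sq \<Longrightarrow>
      ((\<lambda>u. sgn (xv u v)) has_vector_derivative k v *\<^sub>R xu u v) (at u within sq)"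
    using spherical_lines by blast
  obtain l where L: "\<And>v u. v \<in> sq \<Longrightarrow> u \<in> sq \<Longrightarrow>
      ((\<lambda>v. sgn (xu u v)) has_vector_derivative l u *\<^sub>R xv u v) (at v within sq)"
    using S.spherical_lines by blast
  define \<rho> \<sigma> where "\<rho> u v = norm (xv u v)" and "\<sigma> u v = norm (xu u v)" for u v
  have 0: "0 \<in> sq" by (simp add: sq_def)
  have \<rho>: "\<rho> u v > 0" and \<sigma>: "\<sigma> u v > 0" if "u \<in> sq" "v \<in> sq" for u v
    using xu_nonzero[OF that] xv_nonzero[OF that] by (simp_all add: \<rho>_def \<sigma>_def)
  have \<sigma>v: "((\<lambda>v. \<sigma> u v) has_vector_derivative k v * \<rho> u v * \<sigma> u v) (at v within sq)"
    if "u \<in> sq" "v \<in> sq" for u v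
    unfolding \<rho>_def \<sigma>_def by (rule norm_derivative(2)[OF K that])
  have \<rho>u: "((\<lambda>u. \<rho> u v) has_vector_derivative l u * \<sigma> u v * \<rho> u v) (at u within sq)"
    if "u \<in> sq" "v \<in> sq" for u v
    unfolding \<rho>_def \<sigma>_def by (rule S.norm_derivative(2)[OF L that(2,1)])
  \<comment> \<open>The common mixed derivative of \<open>ln \<rho>\<close> and
    \<open>ln \<sigma>\<close>. Continuity of \<open>k\<close> and \<open>l\<close> is not at hand,
    so continuity of \<open>h\<close> is read off a formula in \<open>xu\<close>, \<open>xv\<close>
    and \<open>xw\<close>.\<close>
  define h where "h u v = k v * (l u * \<sigma> u v * \<rho> u v)" for u v
  have h: "continuous_on (sq \<times> sq) (\<lambda>(u, v). h u v)"
  proof -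
    have "continuous_on (sq \<times> sq) (\<lambda>z. ((case z of (u, v) \<Rightarrow> xw u v) \<bullet> (case z of (u, v) \<Rightarrow> xu u v)) *
        ((case z of (u, v) \<Rightarrow> xw u v) \<bullet> (case z of (u, v) \<Rightarrow> xv u v)) /
        ((norm (case z of (u, v) \<Rightarrow> xu u v))\<^sup>2 * (norm (case z of (u, v) \<Rightarrow> xv u v))\<^sup>2))"
      by (intro continuous_intros cont_xu cont_xv cont_xw) (auto simp: xu_nonzero xv_nonzero)
    moreover have "(xw u v \<bullet> xu u v) * (xw u v \<bullet> xv u v) / ((norm (xu u v))\<^sup>2 * (norm (xv u v))\<^sup>2) = h u v"
      if uv: "u \<in> sq" "v \<in> sq" for u v
    proof -
      have "xw u v \<bullet> xu u v = k v * \<rho> u v * (\<sigma> u v)\<^sup>2"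
        unfolding \<rho>_def \<sigma>_def by (rule norm_derivative(1)[OF K uv])
      moreover have "xw u v \<bullet> xv u v = l u * \<sigma> u v * (\<rho> u v)\<^sup>2"
        unfolding \<rho>_def \<sigma>_def by (rule S.norm_derivative(1)[OF L uv(2,1)])
      ultimately show ?thesis
        using \<rho>[OF uv] \<sigma>[OF uv]
        by (simp add: h_def \<rho>_def[symmetric] \<sigma>_def[symmetric] power2_eq_square)
    qed
    ultimately show ?thesis by (auto simp: case_prod_unfold elim!: continuous_on_eq)
  qed
  \<comment> \<open>The quotient of \<open>\<rho>\<close> and \<open>\<sigma>\<close>, normalized to
    1 at \<open>v = 0\<close>; this removes its \<open>u\<close>-dependent factor.\<close>
  define b where "b u v = \<rho> u v * \<sigma> u 0 / (\<sigma> u v * \<rho> u 0)" for u v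
  have b: "b u v = b u' v" if u: "u \<in> sq" "u' \<in> sq" and v: "v \<in> sq" for u u' v
  proof -
    have ln\<sigma>: "((\<lambda>v. ln (\<sigma> u v)) has_vector_derivative k v * \<rho> u v) (at v within sq)"
      if "u \<in> sq" "v \<in> sq" for u v
      using \<sigma>v[OF that] \<sigma>[OF that]
      by (auto simp: has_real_derivative_iff_has_vector_derivative[symmetric]
          intro!: derivative_eq_intros)
    have ln\<rho>: "((\<lambda>u. ln (\<rho> u v)) has_vector_derivative l u * \<sigma> u v) (at u within sq)"
      if "u \<in> sq" "v \<in> sq" for u v
      using \<rho>u[OF that] \<rho>[OF that]
      by (auto simp: has_real_derivative_iff_has_vector_derivative[symmetric]
          intro!: derivative_eq_intros)
    have k\<rho>: "((\<lambda>u. k v * \<rho> u v) has_vector_derivative h u v) (at u within sq)"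
      if "u \<in> sq" "v \<in> sq" for u v
      unfolding h_def by (intro derivative_intros \<rho>u that)
    have int: "integral {0..v} (h u) = l u * \<sigma> u v - l u * \<sigma> u 0" if u: "u \<in> sq" for u
    proof (rule integral_unique, rule fundamental_theorem_of_calculus)
      show "0 \<le> v" using v by (simp add: sq_def)
      fix t assume "t \<in> {0..v}"
      then have t: "t \<in> sq" and sub: "{0..v} \<subseteq> sq" using v by (auto simp: sq_def)
      have "((\<lambda>t. l u * \<sigma> u t) has_vector_derivative l u * (k t * \<rho> u t * \<sigma> u t)) (at t within {0..v})"
        by (intro derivative_intros has_vector_derivative_within_subset[OF \<sigma>v[OF u t] sub])
      then show "((\<lambda>t. l u * \<sigma> u t) has_vector_derivative h u t) (at t within {0..v})"
        by (simp add: h_def mult_ac)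
    qed
    have d0: "((\<lambda>u. (ln (\<rho> u v) - ln (\<rho> u 0)) - (ln (\<sigma> u v) - ln (\<sigma> u 0))) has_vector_derivative 0)
        (at u within sq)" if u: "u \<in> sq" for u
    proof -
      have "((\<lambda>u. ln (\<sigma> u v) - ln (\<sigma> u 0)) has_vector_derivative integral {0..v} (h u)) (at u within sq)"
        by (rule mixed_difference[OF ln\<sigma> k\<rho> h u 0 v]) (use v in \<open>auto simp: sq_def\<close>)
      from has_vector_derivative_diff[OF has_vector_derivative_diff[OF ln\<rho>[OF u v] ln\<rho>[OF u 0]] this]
      show ?thesis by (simp add: int[OF u])
    qed
    have lnb: "ln (b u v) = (ln (\<rho> u v) - ln (\<rho> u 0)) - (ln (\<sigma> u v) - ln (\<sigma> u 0))" if "u \<in> sq" for u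
      using \<rho>[OF that v] \<rho>[OF that 0] \<sigma>[OF that v] \<sigma>[OF that 0]
      by (simp add: b_def ln_div ln_mult)
    have pos: "b u v > 0" if "u \<in> sq" for u
      using \<rho>[OF that v] \<rho>[OF that 0] \<sigma>[OF that v] \<sigma>[OF that 0] by (simp add: b_def)
    have "ln (b u v) = ln (b u' v)"
      unfolding lnb[OF u(1)] lnb[OF u(2)] by (rule constant_of_zero_derivative_sq[OF d0 u])
    then show ?thesis using pos u by simp
  qed
  \<comment> \<open>Chosen so that \<open>w \<rho>\<close> depends only on \<open>v\<close> and \<open>w \<sigma>\<close> only on \<open>u\<close>.\<close>
  define w where "w u v = \<sigma> u 0 / (\<rho> u 0 * \<sigma> u v)" for u v
  have wv: "((\<lambda>v. w u v) has_vector_derivative - (k v * \<rho> u v * w u v)) (at v within sq)"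
    if uv: "u \<in> sq" "v \<in> sq" for u v
    using \<sigma>v[OF uv] \<sigma>[OF uv] \<rho>[OF uv(1) 0] unfolding w_def
    by (auto simp: has_real_derivative_iff_has_vector_derivative[symmetric] power2_eq_square
          intro!: derivative_eq_intros)
  have wb: "w u v * \<rho> u v = b u v" for u v by (simp add: w_def b_def mult.commute)
  \<comment> \<open>The Lorentz vector of the sphere through the \<open>u\<close>-line. The
    derivative of \<open>w\<close> contributes exactly the terms with \<open>k v\<close>.\<close>
  define T where "T u v = (- k v, sgn (xv u v) - k v *\<^sub>R x u v,
      2 * (x u v \<bullet> sgn (xv u v)) - k v * (x u v \<bullet> x u v))" for u v
  have T: "T u v = T u' v" if "u \<in> sq" "u' \<in> sq" "v \<in> sq" for u u' v
    using sphere_invariants[OF K that] by (simp add: T_def)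
  have Fv: "((\<lambda>v. w u v *\<^sub>R lift (x u v)) has_vector_derivative b u v *\<^sub>R T u v) (at v within sq)"
    if uv: "u \<in> sq" "v \<in> sq" for u v
  proof -
    have xvt: "xv u v = \<rho> u v *\<^sub>R sgn (xv u v)"
      using xv_nonzero[OF uv] by (simp add: \<rho>_def sgn_div_norm)
    have "((\<lambda>v. x u v \<bullet> x u v) has_vector_derivative 2 * (x u v \<bullet> xv u v)) (at v within sq)"
      using xv[OF uv] unfolding has_vector_derivative_def
      by (auto intro!: derivative_eq_intros simp: fun_eq_iff inner_commute)
    then have "((\<lambda>v. lift (x u v)) has_vector_derivative (0, xv u v, 2 * (x u v \<bullet> xv u v))) (at v within sq)"
      unfolding lift_def by (intro derivative_intros xv uv)
    from has_vector_derivative_scaleR[OF wv[OF uv, folded has_real_derivative_iff_has_vector_derivative] this]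
    show ?thesis
      by (rule has_vector_derivative_eq_rhs)
         (simp add: T_def lift_def wb[symmetric], subst (1 2) xvt, simp add: algebra_simps)
  qed
  have "separable_lift x w"
    unfolding separable_lift_def
  proof (intro conjI ballI)
    fix u u' v v' assume uv: "u \<in> sq" "u' \<in> sq" "v \<in> sq" "v' \<in> sq"
    show "w u v *\<^sub>R lift (x u v) - w u' v *\<^sub>R lift (x u' v) =
        w u v' *\<^sub>R lift (x u v') - w u' v' *\<^sub>R lift (x u' v')"
    proof (rule constant_of_zero_derivative_sq[OF _ uv(3,4)])
      fix t assume t: "t \<in> sq"
      show "((\<lambda>v. w u v *\<^sub>R lift (x u v) - w u' v *\<^sub>R lift (x u' v)) has_vector_derivative 0) (at t within sq)"
        using has_vector_derivative_diff[OF Fv[OF uv(1) t] Fv[OF uv(2) t]]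
        by (simp add: b[OF uv(1,2) t] T[OF uv(1,2) t])
    qed
  next
    fix u v assume uv: "u \<in> sq" "v \<in> sq"
    then show "w u v > 0" using \<sigma> \<rho> 0 by (simp add: w_def)
  qed
  then show thesis by (rule that)
qed

end

section \<open>The normal along parameter lines, and the Moebius image of a circular net\<close>

lemma sgn_cross3:
  assumes "a \<bullet> b = 0"
  shows "sgn (cross3 a b) = cross3 (sgn a) (sgn b)"
proof -
  have "(norm (cross3 a b))\<^sup>2 = (norm a * norm b)\<^sup>2"
    using norm_cross[of a b] assms by (simp add: power_mult_distrib)
  then have "norm (cross3 a b) = norm a * norm b"
    by (simp add: power2_eq_iff_nonneg)
  then show ?thesis by (simp add: sgn_div_norm cross_mult_left cross_mult_right mult.commute)
qed

lemma bounded_bilinear_cross3: "bounded_bilinear cross3"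
  using bilinear_cross by (simp add: bilinear_conv_bounded_bilinear)

text \<open>The generating curves must be defined on all of \<open>\<real>\<close>; running back and forth avoids an extension.\<close>

lemma C1_closed_up_curve:
  assumes d: "\<And>v. v \<in> sq \<Longrightarrow> (f has_vector_derivative f' v) (at v within sq)"
    and c: "continuous_on sq f'"
  shows "(\<lambda>t. f ((1 + sin t) / 2)) C1_differentiable_on UNIV"
    and "range (\<lambda>t. f ((1 + sin t) / 2)) = f ` sq"
proof -
  let ?\<phi> = "\<lambda>t. (1 + sin t) / 2 :: real"
  have \<phi>: "?\<phi> t \<in> sq" for t
  proof -
    have "- 1 \<le> sin t" by (rule sin_ge_minus_one)
    then have "0 \<le> 1 + sin t" by linarith
    then show ?thesis by (simp add: sq_def)
  qed
  have "(f \<circ> ?\<phi> has_vector_derivative (cos t / 2) *\<^sub>R f' (?\<phi> t)) (at t)" for t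
  proof (rule vector_diff_chain_within)
    show "(?\<phi> has_vector_derivative cos t / 2) (at t)"
      unfolding has_real_derivative_iff_has_vector_derivative[symmetric]
      by (auto intro!: derivative_eq_intros)
    show "(f has_vector_derivative f' (?\<phi> t)) (at (?\<phi> t) within range ?\<phi>)"
      by (rule has_vector_derivative_within_subset[OF d[OF \<phi>]]) (use \<phi> in auto)
  qed
  then show "(\<lambda>t. f (?\<phi> t)) C1_differentiable_on UNIV"
    unfolding C1_differentiable_on_def comp_def
    by (intro exI[of _ "\<lambda>t. (cos t / 2) *\<^sub>R f' (?\<phi> t)"] conjI ballI)
       (use \<phi> in \<open>auto intro!: continuous_intros continuous_on_compose2[OF c]\<close>)
  have "v \<in> range ?\<phi>" if "v \<in> sq" for v
  proof -
    have "?\<phi> (arcsin (2 * v - 1)) = v" using that by (simp add: sq_def sin_arcsin)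
    then show ?thesis by (metis rangeI)
  qed
  then have "range ?\<phi> = sq" using \<phi> by auto
  then show "range (\<lambda>t. f (?\<phi> t)) = f ` sq" by (metis image_image)
qed

context circular_net
begin

lemma nonconstant:
  assumes "u \<in> sq" "v \<in> sq"
  shows "\<exists>u'\<in>sq. x u' v \<noteq> x u v"
proof -
  obtain \<delta> where \<delta>: "\<delta> > 0" "\<And>u1 u2. u1 \<in> sq \<Longrightarrow> u2 \<in> sq \<Longrightarrow> u1 \<noteq> u2 \<Longrightarrow>
    \<bar>u1 - u\<bar> < \<delta> \<Longrightarrow> \<bar>u2 - u\<bar> < \<delta> \<Longrightarrow> x u1 v \<noteq> x u2 v"
    using locally_injective[OF assms] by blast
  obtain u' where "u' \<in> sq" "u' \<noteq> u" "\<bar>u' - u\<bar> < \<delta>"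
    using islimpt_sq[OF assms(1)] \<delta>(1) unfolding islimpt_approachable dist_real_def by blast
  then show ?thesis using \<delta> assms by (intro bexI[of _ u']) auto
qed

lemma gen_inversion_between_lines:
  assumes v: "v0 \<in> sq" "v1 \<in> sq"
  shows "\<exists>f. gen_inversion f \<and> (\<forall>u\<in>sq. f (Some (x u v0)) = Some (x u v1))"
proof (cases "\<exists>u\<in>sq. x u v0 \<noteq> x u v1")
  case True
  then show ?thesis
    using separable gen_inversion_of_separable[OF _ v] by metis
next
  case False
  then show ?thesis using gen_inversion_fixing_line[OF v(1)] by metis
qed

lemma mobius_image_of_dim2:
  assumes sep: "separable_lift x w"
    and dim: "dim ((\<lambda>u. w u 0 *\<^sub>R lift (x u 0) - w 0 0 *\<^sub>R lift (x 0 0)) ` sq) \<le> 2"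
  shows "\<exists>m S. mobius m \<and> (surface_of_revolution S \<or> gen_cone S \<or> gen_cylinder S) \<and>
          (\<forall>u\<in>sq. \<forall>v\<in>sq. m (Some (x u v)) \<in> Some ` S)"
proof -
  interpret S: circular_net "\<lambda>u v. x v u" "\<lambda>u v. xv v u" "\<lambda>u v. xu v u" "\<lambda>u v. xw v u"
    by (rule swap)
  have 0: "0 \<in> sq" by (simp add: sq_def)
  obtain \<delta> where \<delta>: "\<delta> > 0" and inj: "\<And>u1 u2. u1 \<in> sq \<Longrightarrow> u2 \<in> sq \<Longrightarrow> u1 \<noteq> u2 \<Longrightarrow>
    \<bar>u1 - 0\<bar> < \<delta> \<Longrightarrow> \<bar>u2 - 0\<bar> < \<delta> \<Longrightarrow> x u1 0 \<noteq> x u2 0"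
    using locally_injective[OF 0 0] by blast
  \<comment> \<open>The parameters 0, \<open>e / 2\<close> and \<open>e / 3\<close> lie within
    \<open>\<delta>\<close> of 0 and give the three distinct points.\<close>
  define e where "e = min \<delta> 1"
  have e: "e > 0" "e \<le> 1" "e \<le> \<delta>" using \<delta> by (auto simp: e_def)
  have u12: "e / 2 \<in> sq" "e / 3 \<in> sq" using e by (auto simp: sq_def)
  have "continuous_on sq (xv 0)" using S.continuous_on_line_u[OF S.cont_xu 0] .
  note g = C1_closed_up_curve[OF xv[OF 0] this]
  show ?thesis
    by (rule mobius_of_separable_dim2[OF sep g _ _ u12 _ _ _ dim])
       (use nonconstant S.nonconstant inj[OF 0 u12(1)] inj[OF 0 u12(2)] inj[OF u12] e in auto)
qed

text \<open>In the product rule for the cross product of \<open>s\<close> and \<open>t\<close>, the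
  term with the derivative of \<open>t\<close> vanishes, as this derivative is parallel to
  \<open>s\<close>. The other term is a product of two vectors orthogonal to \<open>s\<close>, hence
  parallel to \<open>s\<close>.\<close>

lemma normal_derivative:
  assumes u: "u \<in> sq" and v: "v \<in> sq"
    and xuu: "((\<lambda>u. xu u v) has_vector_derivative a) (at u within sq)"
  shows "\<exists>k. ((\<lambda>u. cross3 (sgn (xu u v)) (sgn (xv u v))) has_vector_derivative k *\<^sub>R xu u v) (at u within sq)"
proof -
  obtain k where K: "((\<lambda>u. sgn (xv u v)) has_vector_derivative k v *\<^sub>R xu u v) (at u within sq)"
    using spherical_lines u v by metis
  define s t where "s = sgn (xu u v)" "t = sgn (xv u v)"
  have ns: "norm s = 1" using xu_nonzero[OF u v] by (simp add: s_t_def norm_sgn)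
  have xus: "xu u v = norm (xu u v) *\<^sub>R s" using xu_nonzero[OF u v] by (simp add: s_t_def sgn_div_norm)
  have st: "s \<bullet> t = 0" using orthogonal[OF u v] by (simp add: s_t_def sgn_div_norm)
  have inv: "((\<lambda>u. inverse (norm (xu u v))) has_real_derivative
      - (inverse (norm (xu u v)) * (a \<bullet> sgn (xu u v)) * inverse (norm (xu u v)))) (at u within sq)"
    using has_vector_derivative_norm[OF xuu xu_nonzero[OF u v]] xu_nonzero[OF u v]
    unfolding has_real_derivative_iff_has_vector_derivative[symmetric]
    by (intro DERIV_inverse') auto
  obtain s' where s': "((\<lambda>u. sgn (xu u v)) has_vector_derivative s') (at u within sq)"
    using has_vector_derivative_scaleR[OF inv xuu] unfolding sgn_div_norm by blast
  \<comment> \<open>A unit vector is orthogonal to its derivative.\<close>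
  have "((\<lambda>u. sgn (xu u v) \<bullet> sgn (xu u v)) has_vector_derivative s \<bullet> s' + s' \<bullet> s) (at u within sq)"
    unfolding s_t_def by (rule bounded_bilinear.has_vector_derivative[OF bounded_bilinear_inner s' s'])
  moreover have "((\<lambda>u. sgn (xu u v) \<bullet> sgn (xu u v)) has_vector_derivative 0) (at u within sq)"
    by (rule has_vector_derivative_transform[OF u _ has_vector_derivative_const[of 1]])
       (use xu_nonzero v in \<open>simp add: dot_square_norm norm_sgn\<close>)
  ultimately have "s \<bullet> s' + s' \<bullet> s = 0"
    by (rule has_vector_derivative_unique_sq) (rule u)
  then have ss': "s \<bullet> s' = 0" by (simp add: inner_commute)
  have "cross3 s (cross3 s' t) = 0" by (simp add: Lagrange st ss')
  then have par: "cross3 s' t = (s \<bullet> cross3 s' t) *\<^sub>R s"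
    using cross3_eq_0_imp_parallel ns by blast
  have D: "((\<lambda>u. cross3 (sgn (xu u v)) (sgn (xv u v))) has_vector_derivative
      cross3 s (k v *\<^sub>R xu u v) + cross3 s' t) (at u within sq)"
    unfolding s_t_def by (rule bounded_bilinear.has_vector_derivative[OF bounded_bilinear_cross3 s' K])
  have z: "cross3 s (k v *\<^sub>R xu u v) = 0"
    by (subst xus) (simp add: cross_mult_right)
  have seq: "s = (1 / norm (xu u v)) *\<^sub>R xu u v"
    using xu_nonzero[OF u v] by (simp add: s_t_def sgn_div_norm inverse_eq_divide)
  define c where "c = s \<bullet> cross3 s' t"
  have "cross3 s (k v *\<^sub>R xu u v) + cross3 s' t = c *\<^sub>R s"
    unfolding z add_0_left c_def by (rule par)
  also have "\<dots> = (c / norm (xu u v)) *\<^sub>R xu u v"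
    by (subst seq) simp
  finally have "((\<lambda>u. cross3 (sgn (xu u v)) (sgn (xv u v))) has_vector_derivative
      (c / norm (xu u v)) *\<^sub>R xu u v) (at u within sq)"
    using D by simp
  then show ?thesis by blast
qed

text \<open>The two families of differences are orthogonal in dimension 5, so one of them spans at
  most a plane.\<close>

lemma mobius_image:
  "\<exists>m S. mobius m \<and> (surface_of_revolution S \<or> gen_cone S \<or> gen_cylinder S) \<and>
          (\<forall>u\<in>sq. \<forall>v\<in>sq. m (Some (x u v)) \<in> Some ` S)"
proof -
  interpret S: circular_net "\<lambda>u v. x v u" "\<lambda>u v. xv v u" "\<lambda>u v. xu v u" "\<lambda>u v. xw v u"
    by (rule swap)
  obtain w where sep: "separable_lift x w" using separable .
  have 0: "0 \<in> sq" by (simp add: sq_def)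
  let ?U = "(\<lambda>u. w u 0 *\<^sub>R lift (x u 0) - w 0 0 *\<^sub>R lift (x 0 0)) ` sq"
  let ?V = "(\<lambda>v. w 0 v *\<^sub>R lift (x 0 v) - w 0 0 *\<^sub>R lift (x 0 0)) ` sq"
  have "dim ?U + dim ?V \<le> 5"
    by (rule dim_lor_orthogonal) (use separable_lift_orthogonal[OF sep _ 0 0 _ 0 0] in auto)
  then consider "dim ?U \<le> 2" | "dim ?V \<le> 2" by linarith
  then show ?thesis
  proof cases
    case 1
    then show ?thesis by (rule mobius_image_of_dim2[OF sep])
  next
    case 2
    then show ?thesis using S.mobius_image_of_dim2[OF separable_lift_swap[OF sep]] by blast
  qed
qed

end

section \<open>From smooth patches to circular nets\<close>

theorem theorem6p8:
  fixes x :: "real \<Rightarrow> real \<Rightarrow> real^3"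
  assumes smooth: "smooth_patch x"
    and regular: "regular_patch x"
    and generic: "generic_patch x"
    and circular: "\<And>u0 u1 v0 v1. u0 \<in> sq \<Longrightarrow> u1 \<in> sq \<Longrightarrow> v0 \<in> sq \<Longrightarrow> v1 \<in> sq \<Longrightarrow>
        u0 < u1 \<Longrightarrow> v0 < v1 \<Longrightarrow>
        concyclic {x u0 v0, x u1 v0, x u1 v1, x u0 v1}"
  shows "parameter_lines_principal x
    \<and> (\<exists>m S. mobius m \<and> (surface_of_revolution S \<or> gen_cone S \<or> gen_cylinder S) \<and>
          (\<forall>u\<in>sq. \<forall>v\<in>sq. m (Some (x u v)) \<in> Some ` S))
    \<and> (\<forall>v0\<in>sq. \<forall>v1\<in>sq. v0 \<noteq> v1 \<longrightarrow> (\<exists>f. gen_inversion f \<and>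
          (\<forall>u\<in>sq. f (Some (x u v0)) = Some (x u v1))))
    \<and> (\<forall>u0\<in>sq. \<forall>u1\<in>sq. u0 \<noteq> u1 \<longrightarrow> (\<exists>f. gen_inversion f \<and>
          (\<forall>v\<in>sq. f (Some (x u0 v)) = Some (x u1 v))))"
proof -
  have cont: "continuous_on (sq \<times> sq) (\<lambda>(u, v). pd bs x u v)"
    and du: "u \<in> sq \<Longrightarrow> v \<in> sq \<Longrightarrow>
      ((\<lambda>t. pd bs x t v) has_vector_derivative pdu (pd bs x) u v) (at u within sq)"
    and dv: "u \<in> sq \<Longrightarrow> v \<in> sq \<Longrightarrow>
      ((\<lambda>t. pd bs x u t) has_vector_derivative pdv (pd bs x) u v) (at v within sq)" for bs u v
    using smooth unfolding smooth_patch_def pdu_def pdv_def vector_derivative_works[symmetric] by blast+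
  have "circular_net x (pdu x) (pdv x) (pdu (pdv x))"
  proof
    show cw: "continuous_on (sq \<times> sq) (\<lambda>(u, v). pdu (pdv x) u v)"
      using cont[of "[True, False]"] by simp
    \<comment> \<open>Smoothness provides \<open>pdu (pdv x)\<close> as the
      \<open>u\<close>-derivative of \<open>pdv x\<close>; here it is identified with the other
      mixed derivative.\<close>
    show "((\<lambda>v. pdu x u v) has_vector_derivative pdu (pdv x) u v) (at v within sq)"
      if "u \<in> sq" "v \<in> sq" for u v
      by (rule mixed_partials_eq[OF _ _ _ cw that])
         (use du[of _ _ "[]"] dv[of _ _ "[]"] du[of _ _ "[False]"] in auto)
    show "concyclic {x u0 v0, x u1 v0, x u0 v1, x u1 v1}"
      if "u0 \<in> sq" "u1 \<in> sq" "v0 \<in> sq" "v1 \<in> sq" "u0 \<noteq> u1" "v0 \<noteq> v1" for u0 u1 v0 v1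
      using circular[OF that(1-4)] circular[OF that(2,1,3,4)] circular[OF that(1,2,4,3)]
        circular[OF that(2,1,4,3)] that(5,6)
      by (cases "u0 < u1"; cases "v0 < v1") (simp_all add: insert_commute)
  qed (use cont[of "[True]"] cont[of "[False]"] du[of _ _ "[]"] dv[of _ _ "[]"] du[of _ _ "[False]"]
        regular in \<open>auto simp: regular_patch_def\<close>)
  then interpret N: circular_net x "pdu x" "pdv x" "pdu (pdv x)" .
  interpret S: circular_net "\<lambda>u v. x v u" "\<lambda>u v. pdv x v u" "\<lambda>u v. pdu x v u" "\<lambda>u v. pdu (pdv x) v u"
    by (rule N.swap)
  \<comment> \<open>Orthogonality of the parameter lines turns the normal into a product of unit
    tangents, the form treated by \<open>normal_derivative\<close>.\<close>
  have nrm: "unit_normal x u v = cross3 (sgn (pdu x u v)) (sgn (pdv x u v))"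
    if "u \<in> sq" "v \<in> sq" for u v
    unfolding unit_normal_def by (rule sgn_cross3[OF N.orthogonal[OF that]])
  have "parameter_lines_principal x"
    unfolding parameter_lines_principal_def
  proof (intro ballI conjI)
    fix u v assume uv: "u \<in> sq" "v \<in> sq"
    obtain k where "((\<lambda>u. cross3 (sgn (pdu x u v)) (sgn (pdv x u v))) has_vector_derivative
        k *\<^sub>R pdu x u v) (at u within sq)"
      using N.normal_derivative[OF uv] du[OF uv, of "[True]"] by auto
    then have "((\<lambda>u. unit_normal x u v) has_vector_derivative k *\<^sub>R pdu x u v) (at u within sq)"
      by (rule has_vector_derivative_transform[OF uv(1), rotated]) (simp add: nrm uv)
    then show "\<exists>k. pdu (unit_normal x) u v = k *\<^sub>R pdu x u v"
      unfolding pdu_def[of "unit_normal x"]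
      using vector_derivative_within[OF at_within_sq_nontrivial[OF uv(1)]] by blast
    obtain k where "((\<lambda>v. cross3 (sgn (pdv x u v)) (sgn (pdu x u v))) has_vector_derivative
        k *\<^sub>R pdv x u v) (at v within sq)"
      using S.normal_derivative[OF uv(2,1)] dv[OF uv, of "[False]"] by auto
    \<comment> \<open>Exchanging the parameters reverses the normal.\<close>
    from has_vector_derivative_minus[OF this]
    have *: "((\<lambda>v. cross3 (sgn (pdu x u v)) (sgn (pdv x u v))) has_vector_derivative
        (- k) *\<^sub>R pdv x u v) (at v within sq)"
      by (simp add: cross_skew[symmetric])
    have "((\<lambda>v. unit_normal x u v) has_vector_derivative (- k) *\<^sub>R pdv x u v) (at v within sq)"
      by (rule has_vector_derivative_transform[OF uv(2) _ *]) (simp add: nrm uv)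
    then show "\<exists>k. pdv (unit_normal x) u v = k *\<^sub>R pdv x u v"
      unfolding pdv_def[of "unit_normal x"]
      using vector_derivative_within[OF at_within_sq_nontrivial[OF uv(2)]] by blast
  qed
  then show ?thesis
    by (intro conjI ballI impI N.mobius_image N.gen_inversion_between_lines
        S.gen_inversion_between_lines)
qed

end
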